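(* Let $f:\mathbb R^d\to\mathbb R$ be $L_{\text{semi}}$-semi-strongly self-concordant, let $\mathcal Q(x^0)=\{x\in\mathbb R^d: f(x)\le f(x^0)\}$ and suppose $R=\sup_{x,y\in\mathcal Q(x^0)}\|x-y\|_x<\infty$. Let the distribution $\mathcal D$ of sketch matrices satisfy, for some $\tau>0$, $\mathbb E_{\mathbf S\sim\mathcal D}[\mathbf P_x]=\frac{\tau}{d}\mathbf I$ for all $x\in\mathbb R^d$. Then the iterates of SGN with parameter $L_{\text{alg}}\ge L_{\text{semi}}$ satisfy, for every $k\ge1$, $$\mathbb E\left[f(x^k)-f^*\right]\le\frac{4d^3(f(x^0)-f^* )}{\tau^3k^3}+\frac{9(L_{\text{alg}}+L_{\text{semi}})d^2R^3}{2\tau^2k^2}.$$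
   Context: Throughout, $f:\mathbb R^d\to\mathbb R$ is convex, twice differentiable with positive definite Hessian, bounded from below, with minimizer $x^*$ and $f^*=f(x^* )$. Local norms: $\|h\|_x=\langle\nabla^2 f(x)h,h\rangle^{1/2}$ and $\|g\|_x^*=\langle g,\nabla^2 f(x)^{-1}g\rangle^{1/2}$. $f$ is $L_{\text{semi}}$-semi-strongly self-concordant if for all $x,y\in\mathbb R^d$, $\sup_{v\ne0}\frac{\|(\nabla^2 f(y)-\nabla^2 f(x))v\|_x^*}{\|v\|_x}\le L_{\text{semi}}\|y-x\|_x$. For $\mathbf S\in\mathbb R^{d\times\tau(\mathbf S)}$: $\nabla_{\mathbf S}f(x)=\mathbf S^\top\nabla f(x)$, $\nabla^2_{\mathbf S}f(x)=\mathbf S^\top\nabla^2 f(x)\mathbf S$, $\|g\|^*_{x,\mathbf S}=\langle g,[\nabla^2_{\mathbf S}f(x)]^\dagger g\rangle^{1/2}$ ($\dagger$ is the Moore–Penrose pseudoinverse), and $\mathbf P_x=\mathbf S(\mathbf S^\top\nabla^2 f(x)\mathbf S)^\dagger\mathbf S^\top\nabla^2 f(x)$. SGN (Sketchy Global Newton): given $x^0\in\mathbb R^d$ and $L_{\text{alg}}\geq L_{\text{semi}}>0$, for $k=0,1,2,\dots$ sample $\mathbf S_k\sim\mathcal D$ (independently of the past) and set $x^{k+1}=x^k-\alpha_k\mathbf S_k[\nabla^2_{\mathbf S_k}f(x^k)]^\dagger\nabla_{\mathbf S_k}f(x^k)$, where $\alpha_k=\frac{-1+\sqrt{1+2G_k}}{G_k}$,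 $G_k=L_{\text{alg}}\|\nabla_{\mathbf S_k}f(x^k)\|^*_{x^k,\mathbf S_k}$ (with $\alpha_k=1$ if $G_k=0$). *)

theory Defs
  imports "HOL-Probability.Probability" "Jordan_Normal_Form.Matrix"
begin

(* Both vector libraries claim these symbols.  Below they have their HOL-Analysis meaning;
   Jordan_Normal_Form is used only for matrices whose size varies with the sketch. *)
no_notation Matrix.vec_index (infixl \<open>$\<close> 100)
no_notation Matrix.scalar_prod (infix \<open>\<bullet>\<close> 70)

section \<open>Derivatives and local norms\<close>

definition gradient :: "(real^'d \<Rightarrow> real) \<Rightarrow> real^'d \<Rightarrow> real^'d" where
  "gradient f x = (THE g. GDERIV f x :> g)"

definition hessian :: "(real^'d \<Rightarrow> real) \<Rightarrow> real^'d \<Rightarrow> real^'d^'d" where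
  "hessian f x = matrix (frechet_derivative (gradient f) (at x))"

definition twice_differentiable :: "(real^'d \<Rightarrow> real) \<Rightarrow> bool" where
  "twice_differentiable f \<longleftrightarrow>
     (\<forall>x. f differentiable (at x)) \<and> (\<forall>x. gradient f differentiable (at x))"

definition positive_definite :: "real^'d^'d \<Rightarrow> bool" where
  "positive_definite A \<longleftrightarrow> transpose A = A \<and> (\<forall>h. h \<noteq> 0 \<longrightarrow> (A *v h) \<bullet> h > 0)"

definition local_norm :: "(real^'d \<Rightarrow> real) \<Rightarrow> real^'d \<Rightarrow> real^'d \<Rightarrow> real" where
  "local_norm f x h = sqrt ((hessian f x *v h) \<bullet> h)"

definition dual_norm :: "(real^'d \<Rightarrow> real) \<Rightarrow> real^'d \<Rightarrow> real^'d \<Rightarrow> real" where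
  "dual_norm f x g = sqrt (g \<bullet> (matrix_inv (hessian f x) *v g))"

(* The suprema are taken in the extended reals, where they always exist. *)
definition semi_strongly_self_concordant :: "real \<Rightarrow> (real^'d \<Rightarrow> real) \<Rightarrow> bool" where
  "semi_strongly_self_concordant L f \<longleftrightarrow>
     (\<forall>x y. (SUP v\<in>{v. v \<noteq> 0}.
                ereal (dual_norm f x ((hessian f y - hessian f x) *v v) / local_norm f x v))
            \<le> ereal (L * local_norm f x (y - x)))"

definition sublevel :: "(real^'d \<Rightarrow> real) \<Rightarrow> real^'d \<Rightarrow> (real^'d) set" where
  "sublevel f x0 = {x. f x \<le> f x0}"

definition sublevel_diameter :: "(real^'d \<Rightarrow> real) \<Rightarrow> real^'d \<Rightarrow> ereal" where
  "sublevel_diameter f x0 =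
     (SUP x\<in>sublevel f x0. SUP y\<in>sublevel f x0. ereal (local_norm f x (x - y)))"

section \<open>Pseudoinverse\<close>

definition is_pseudoinverse :: "real Matrix.mat \<Rightarrow> real Matrix.mat \<Rightarrow> bool" where
  "is_pseudoinverse A X \<longleftrightarrow>
     X \<in> carrier_mat (dim_col A) (dim_row A) \<and>
     A * X * A = A \<and> X * A * X = X \<and>
     transpose_mat (A * X) = A * X \<and> transpose_mat (X * A) = X * A"

definition pseudoinverse :: "real Matrix.mat \<Rightarrow> real Matrix.mat" where
  "pseudoinverse A = (THE X. is_pseudoinverse A X)"

section \<open>Sketch matrices\<close>

(* A sketch matrix with d rows and any number of columns is the list of its columns;
   the number of columns is the length of the list. *)
type_synonym 'd sketch = "(real^'d) list"

definition sketch_column :: "'d sketch \<Rightarrow> nat \<Rightarrow> real^'d" where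
  "sketch_column S i = (if i < length S then S ! i else 0)"

(* The Borel sigma-algebra of the disjoint union, over n, of the spaces of matrices with n columns. *)
definition sketch_space :: "('d::finite) sketch measure" where
  "sketch_space = vimage_algebra UNIV (\<lambda>S. (length S, sketch_column S))
     (count_space UNIV \<Otimes>\<^sub>M (\<Pi>\<^sub>M i\<in>UNIV. borel))"

lemma measurable_sketch_space_iff:
  "X \<in> measurable M (sketch_space :: ('d::finite) sketch measure) \<longleftrightarrow>
     (\<lambda>\<omega>. length (X \<omega>)) \<in> measurable M (count_space UNIV) \<and>
     (\<forall>i. (\<lambda>\<omega>. sketch_column (X \<omega>) i) \<in> borel_measurable M)"
proof -
  have range: "(\<lambda>S::'d sketch. (length S, sketch_column S)) \<in>
      UNIV \<rightarrow> space (count_space UNIV \<Otimes>\<^sub>M (\<Pi>\<^sub>M i\<in>(UNIV::nat set). borel))"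
    by (auto simp: space_pair_measure space_PiM)
  have "X \<in> measurable M sketch_space \<longleftrightarrow>
      (\<lambda>\<omega>. (length (X \<omega>), sketch_column (X \<omega>)))
        \<in> measurable M (count_space UNIV \<Otimes>\<^sub>M (\<Pi>\<^sub>M i\<in>(UNIV::nat set). borel))"
  proof
    assume "X \<in> measurable M sketch_space"
    then show "(\<lambda>\<omega>. (length (X \<omega>), sketch_column (X \<omega>)))
        \<in> measurable M (count_space UNIV \<Otimes>\<^sub>M (\<Pi>\<^sub>M i\<in>(UNIV::nat set). borel))"
      unfolding sketch_space_def
      using measurable_compose[OF _ measurable_vimage_algebra1[OF range]] by blast
  next
    assume "(\<lambda>\<omega>. (length (X \<omega>), sketch_column (X \<omega>)))
        \<in> measurable M (count_space UNIV \<Otimes>\<^sub>M (\<Pi>\<^sub>M i\<in>(UNIV::nat set). borel))"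
    then show "X \<in> measurable M sketch_space"
      unfolding sketch_space_def by (intro measurable_vimage_algebra2) auto
  qed
  also have "\<dots> \<longleftrightarrow> (\<lambda>\<omega>. length (X \<omega>)) \<in> measurable M (count_space UNIV) \<and>
      (\<lambda>\<omega>. sketch_column (X \<omega>)) \<in> measurable M (\<Pi>\<^sub>M i\<in>(UNIV::nat set). borel)"
    by (simp add: measurable_pair_iff comp_def)
  also have "(\<lambda>\<omega>. sketch_column (X \<omega>)) \<in> measurable M (\<Pi>\<^sub>M i\<in>(UNIV::nat set). borel) \<longleftrightarrow>
      (\<forall>i. (\<lambda>\<omega>. sketch_column (X \<omega>) i) \<in> borel_measurable M)"
  proof
    assume "(\<lambda>\<omega>. sketch_column (X \<omega>)) \<in> measurable M (\<Pi>\<^sub>M i\<in>(UNIV::nat set). borel)"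
    then show "\<forall>i. (\<lambda>\<omega>. sketch_column (X \<omega>) i) \<in> borel_measurable M"
      by (auto intro: measurable_compose[OF _ measurable_component_singleton[OF UNIV_I], where f = "\<lambda>\<omega>. sketch_column (X \<omega>)"])
  next
    assume "\<forall>i. (\<lambda>\<omega>. sketch_column (X \<omega>) i) \<in> borel_measurable M"
    then show "(\<lambda>\<omega>. sketch_column (X \<omega>)) \<in> measurable M (\<Pi>\<^sub>M i\<in>(UNIV::nat set). borel)"
      by (intro measurable_PiM_single') auto
  qed
  finally show ?thesis .
qed

(* S^T g *)
definition sketch_adjoint :: "'d sketch \<Rightarrow> real^('d::finite) \<Rightarrow> real Matrix.vec" where
  "sketch_adjoint S g = Matrix.vec (length S) (\<lambda>i. S ! i \<bullet> g)"

(* S u *)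
definition sketch_apply :: "'d sketch \<Rightarrow> real Matrix.vec \<Rightarrow> real^('d::finite)" where
  "sketch_apply S u = (\<Sum>i<length S. vec_index u i *\<^sub>R S ! i)"

definition sketched_gradient ::
    "(real^'d \<Rightarrow> real) \<Rightarrow> 'd sketch \<Rightarrow> real^('d::finite) \<Rightarrow> real Matrix.vec" where
  "sketched_gradient f S x = sketch_adjoint S (gradient f x)"

(* S^T H S, whose (i, j) entry is the product of column i of S with H times column j of S *)
definition sketched_hessian ::
    "(real^'d \<Rightarrow> real) \<Rightarrow> 'd sketch \<Rightarrow> real^('d::finite) \<Rightarrow> real Matrix.mat" where
  "sketched_hessian f S x =
     Matrix.mat (length S) (length S) (\<lambda>(i, j). S ! i \<bullet> (hessian f x *v S ! j))"

definition sketched_dual_norm ::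
    "(real^'d \<Rightarrow> real) \<Rightarrow> real^('d::finite) \<Rightarrow> 'd sketch \<Rightarrow> real Matrix.vec \<Rightarrow> real" where
  "sketched_dual_norm f x S g =
     sqrt (scalar_prod g (pseudoinverse (sketched_hessian f S x) *\<^sub>v g))"

definition projection ::
    "(real^'d \<Rightarrow> real) \<Rightarrow> real^('d::finite) \<Rightarrow> 'd sketch \<Rightarrow> real^'d^'d" where
  "projection f x S =
     matrix (\<lambda>h. sketch_apply S
       (pseudoinverse (sketched_hessian f S x) *\<^sub>v sketch_adjoint S (hessian f x *v h)))"

section \<open>Sketchy Global Newton\<close>

definition sgn_G ::
    "real \<Rightarrow> (real^'d \<Rightarrow> real) \<Rightarrow> 'd sketch \<Rightarrow> real^('d::finite) \<Rightarrow> real" where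
  "sgn_G L f S x = L * sketched_dual_norm f x S (sketched_gradient f S x)"

definition sgn_stepsize ::
    "real \<Rightarrow> (real^'d \<Rightarrow> real) \<Rightarrow> 'd sketch \<Rightarrow> real^('d::finite) \<Rightarrow> real" where
  "sgn_stepsize L f S x =
     (let G = sgn_G L f S x in if G = 0 then 1 else (-1 + sqrt (1 + 2 * G)) / G)"

definition sgn_step ::
    "real \<Rightarrow> (real^'d \<Rightarrow> real) \<Rightarrow> 'd sketch \<Rightarrow> real^('d::finite) \<Rightarrow> real^'d" where
  "sgn_step L f S x =
     x - sgn_stepsize L f S x *\<^sub>R
       sketch_apply S (pseudoinverse (sketched_hessian f S x) *\<^sub>v sketched_gradient f S x)"

primrec sgn_iterate ::
    "real \<Rightarrow> (real^'d \<Rightarrow> real) \<Rightarrow> real^('d::finite) \<Rightarrow> (nat \<Rightarrow> 'd sketch) \<Rightarrow> nat \<Rightarrow> real^'d"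
where
  "sgn_iterate L f x0 S 0 = x0"
| "sgn_iterate L f x0 S (Suc k) = sgn_step L f (S k) (sgn_iterate L f x0 S k)"

end

theory Submission
  imports Defs
begin

text \<open>
A sketched step minimises a cubic upper model over the range of the sketch, and the averaging
hypothesis turns the minimum over this random subspace into the full cubic Newton model scaled by
\<open>p = \<tau> / d\<close>.

Along a line, semi-strong self-concordance says that the second derivative changes at rate at most
\<open>L * norm^3\<close>.  Integrating twice bounds \<open>f (x + h)\<close> from both sides by its second-order Taylor
polynomial plus or minus \<open>(L / 6) * norm^3\<close>, with all norms local at \<open>x\<close> (\<open>cubic_upper_model\<close>,
\<open>cubic_lower_model\<close>).

The sketched Newton direction \<open>q\<close> is the Galerkin solution of \<open>H q = g\<close> in the range of the sketch:
\<open>q\<close> lies in that range and \<open>u \<bullet> H q = u \<bullet> g\<close> for all \<open>u\<close> in it.  So \<open>P_x h\<close>, which is the Galerkin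
solution with right-hand side \<open>H h\<close>, is the \<open>H\<close>-orthogonal projection of \<open>h\<close>.  The stepsize is the root of the
quadratic equation that makes the step the minimiser of the upper model over the range of the
sketch; therefore \<open>f\<close> after the step is at most the model at every \<open>w\<close> in the range
(\<open>sgn_step_le_model\<close>).  For \<open>w = P_x h\<close> one has \<open>norm w ^ 2 = w \<bullet> H h\<close> and \<open>norm w \<le> norm h\<close>, so that the
model is bounded by an affine function of the matrix \<open>P_x\<close>, whose expectation is
known: \<open>E f(x+) \<le> f x + p * (h \<bullet> g + norm h ^ 2 / 2 + (L_alg / 6) * norm h ^ 3)\<close>.  Taking
\<open>h = \<eta> (x* - x)\<close> and bounding the bracket by the lower model and convexity gives
\<open>\<delta>(k+1) \<le> (1 - p \<eta>) \<delta>(k) + p C \<eta>^3\<close> with \<open>C = (L_alg + L_semi) R^3 / 6\<close>, for every \<open>\<eta>\<close> in \<open>[0,1]\<close>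
(\<open>expected_progress\<close>, \<open>expected_gap_recursion\<close>).  The radius \<open>R\<close> applies at every iterate, because
no sketch increases \<open>f\<close>.  Weights growing like \<open>k^3\<close> turn the recursion into the rate
(\<open>cubic_recursion_rate\<close>).

Two facts must be supplied on the way.  Every real matrix has a unique Moore-Penrose inverse
(\<open>is_pseudoinverse_pseudoinverse\<close>).  The step depends measurably on sketch and point, although
the pseudoinverse is discontinuous: the sketched Newton direction is a limit of solutions of regularised
\<open>d\<close>-dimensional systems, which Cramer's rule makes rational in their coefficients
(\<open>ridge_newton_tendsto\<close>).
\<close>

section \<open>Existence and uniqueness of the pseudoinverse\<close>

text \<open>Associativity is stated with dimension equations in place of carriers: the carrier form has
intermediate dimensions that occur only in the premises, so rewriting with it has to guess them.\<close>
declare assoc_mult_mat [simp del]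

lemma mult_mat_assoc:
  fixes A B C :: "real Matrix.mat"
  shows "dim_col A = dim_row B \<Longrightarrow> dim_col B = dim_row C \<Longrightarrow> A * B * C = A * (B * C)"
  by (rule assoc_mult_mat[of A "dim_row A" "dim_col A" B "dim_col B" C "dim_col C"]) auto

lemma transpose_mult_mat:
  fixes A B :: "real Matrix.mat"
  shows "dim_col A = dim_row B \<Longrightarrow> transpose_mat (A * B) = transpose_mat B * transpose_mat A"
  by (rule transpose_mult[of A "dim_row A" "dim_col A" B "dim_col B"]) auto

text \<open>Subtracting \<open>M U M\<close> is one step of Gaussian elimination when \<open>U\<close> is a scaled matrix unit.  A
generalized inverse of what is left lifts to \<open>M\<close>, because \<open>M (1 - U M)\<close> and \<open>(1 - M U) M\<close> are both
equal to \<open>M - M U M\<close>.\<close>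
lemma generalized_inverse_from_deflation:
  fixes M U G :: "real Matrix.mat"
  assumes M: "M \<in> carrier_mat n m" and U: "U \<in> carrier_mat m n" and G: "G \<in> carrier_mat m n"
    and inv: "(M - M * U * M) * G * (M - M * U * M) = M - M * U * M"
  shows "M * ((1\<^sub>m m - U * M) * G * (1\<^sub>m n - M * U) + U) * M = M"
proof -
  define F where "F = 1\<^sub>m m - U * M"
  define E where "E = 1\<^sub>m n - M * U"
  have F: "F \<in> carrier_mat m m" and E: "E \<in> carrier_mat n n"
    using M U by (auto simp: F_def E_def)
  have MF: "M * F = M - M * U * M"
    unfolding F_def using M U by (simp add: mult_mat_assoc mult_minus_distrib_mat[of _ n m _ m])
  have EM: "E * M = M - M * U * M"
    unfolding E_def using M U by (simp add: minus_mult_distrib_mat[of _ n n _ _ m])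
  have "M * (F * G * E + U) * M = M * F * G * (E * M) + M * U * M"
    using M U G F E by (simp add: mult_add_distrib_mat[of _ n m _ n] add_mult_distrib_mat[of _ n n _ _ m]
      mult_mat_assoc)
  also have "\<dots> = M - M * U * M + M * U * M"
    using inv MF EM by simp
  also have "\<dots> = M" using M U by (intro eq_matI) auto
  finally show ?thesis unfolding F_def E_def .
qed

text \<open>Induction on the number of nonzero rows: with \<open>U\<close> supported at the transposed position of a
nonzero entry, \<open>M - M U M\<close> loses the pivot row and no zero row becomes nonzero.\<close>
lemma generalized_inverse_exists:
  fixes M :: "real Matrix.mat"
  assumes "M \<in> carrier_mat n m"
  shows "\<exists>G \<in> carrier_mat m n. M * G * M = M"
  using assms
proof (induction "card {i. i < n \<and> Matrix.row M i \<noteq> 0\<^sub>v m}" arbitrary: M rule: less_induct)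
  case less
  note M = less.prems
  show ?case
  proof (cases "M = 0\<^sub>m n m")
    case True
    then show ?thesis by (intro bexI[of _ "0\<^sub>m m n"]) auto
  next
    case False
    then obtain a b where ab: "a < n" "b < m" "M $$ (a, b) \<noteq> 0"
      using M by (metis carrier_matD eq_matI index_zero_mat)
    define U where "U = Matrix.mat m n (\<lambda>(i, j). if i = b \<and> j = a then 1 / M $$ (a, b) else 0 :: real)"
    have U: "U \<in> carrier_mat m n" by (simp add: U_def)
    define M' where "M' = M - M * U * M"
    have M': "M' \<in> carrier_mat n m"
      unfolding M'_def by (rule minus_carrier_mat[OF mult_carrier_mat[OF mult_carrier_mat[OF M U] M]])
    have MU: "(M * U) $$ (i, j) = (if j = a then M $$ (i, b) / M $$ (a, b) else 0)" if "i < n" "j < n" for i j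
    proof -
      have "(M * U) $$ (i, j) = (\<Sum>k<m. M $$ (i, k) * (if k = b \<and> j = a then 1 / M $$ (a, b) else 0))"
        using that M U by (auto simp: scalar_prod_def U_def atLeast0LessThan intro!: sum.cong)
      also have "\<dots> = (\<Sum>k<m. if k = b then (if j = a then M $$ (i, b) / M $$ (a, b) else 0) else 0)"
        by (intro sum.cong) auto
      finally show ?thesis using ab by simp
    qed
    have entry: "M' $$ (i, j) = M $$ (i, j) - M $$ (i, b) / M $$ (a, b) * M $$ (a, j)" if "i < n" "j < m" for i j
    proof -
      have "(M * U * M) $$ (i, j) = (\<Sum>k<n. (M * U) $$ (i, k) * M $$ (k, j))"
        using that M U by (auto simp: scalar_prod_def atLeast0LessThan intro!: sum.cong)
      also have "\<dots> = (\<Sum>k<n. if k = a then M $$ (i, b) / M $$ (a, b) * M $$ (a, j) else 0)"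
        using that by (intro sum.cong) (auto simp: MU)
      finally show ?thesis using ab that M U by (simp add: M'_def)
    qed
    have row_a: "Matrix.row M' a = 0\<^sub>v m"
      using M' ab by (intro eq_vecI) (auto simp: entry)
    have row_i: "Matrix.row M' i = 0\<^sub>v m" if "i < n" "Matrix.row M i = 0\<^sub>v m" for i
    proof -
      have "M $$ (i, j) = 0" if "j < m" for j
        using M \<open>i < n\<close> \<open>Matrix.row M i = 0\<^sub>v m\<close> that by (metis carrier_matD index_row(1) index_zero_vec(1))
      then show ?thesis using M' ab that by (intro eq_vecI) (auto simp: entry)
    qed
    have "Matrix.row M a \<noteq> 0\<^sub>v m"
      using M ab by (metis carrier_matD index_row(1) index_zero_vec(1))
    then have "{i. i < n \<and> Matrix.row M' i \<noteq> 0\<^sub>v m} \<subset> {i. i < n \<and> Matrix.row M i \<noteq> 0\<^sub>v m}"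
      using row_a row_i ab by blast
    then have "card {i. i < n \<and> Matrix.row M' i \<noteq> 0\<^sub>v m} < card {i. i < n \<and> Matrix.row M i \<noteq> 0\<^sub>v m}"
      by (intro psubset_card_mono) auto
    from less.hyps[OF this M'] obtain G where G: "G \<in> carrier_mat m n" "M' * G * M' = M'" by blast
    show ?thesis
      using generalized_inverse_from_deflation[OF M U G(1)] G(2) M U G(1) unfolding M'_def
      by (intro bexI[of _ "(1\<^sub>m m - U * M) * G * (1\<^sub>m n - M * U) + U"]) auto
  qed
qed

lemma mat_mult_transpose_self_zero:
  fixes A :: "real Matrix.mat"
  assumes A: "A \<in> carrier_mat n m" and 0: "transpose_mat A * A = 0\<^sub>m m m"
  shows "A = 0\<^sub>m n m"
proof (rule eq_matI)
  fix i j assume ij: "i < dim_row (0\<^sub>m n m :: real Matrix.mat)" "j < dim_col (0\<^sub>m n m :: real Matrix.mat)"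
  have "(\<Sum>k<n. (A $$ (k, j))\<^sup>2) = (transpose_mat A * A) $$ (j, j)"
    using A ij by (auto simp: scalar_prod_def atLeast0LessThan power2_eq_square intro!: sum.cong)
  also have "\<dots> = 0" using 0 ij by simp
  finally have "A $$ (i, j) = 0" using ij by (simp add: sum_nonneg_eq_0_iff)
  then show "A $$ (i, j) = (0\<^sub>m n m :: real Matrix.mat) $$ (i, j)" using ij by simp
qed (use A in auto)

lemma gram_cancel_left:
  fixes A :: "real Matrix.mat"
  assumes A: "A \<in> carrier_mat n m" and B: "B \<in> carrier_mat m l" and C: "C \<in> carrier_mat m l"
    and eq: "transpose_mat A * (A * B) = transpose_mat A * (A * C)"
  shows "A * B = A * C"
proof -
  let ?D = "B - C"
  have D: "?D \<in> carrier_mat m l" using B C by auto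
  have "transpose_mat (A * ?D) * (A * ?D) = transpose_mat ?D * (transpose_mat A * (A * ?D))"
    using A B C by (simp add: transpose_mult_mat mult_mat_assoc)
  also have "A * ?D = A * B - A * C" using A B C by (simp add: mult_minus_distrib_mat[of _ n m _ l])
  also have "transpose_mat A * (A * B - A * C) = 0\<^sub>m m l"
    using A B C eq by (simp add: mult_minus_distrib_mat[of _ m n _ l])
  finally have "transpose_mat (A * B - A * C) * (A * B - A * C) = 0\<^sub>m l l"
    using D A B C by (auto simp: mult_minus_distrib_mat[of _ n m _ l])
  then have "A * B - A * C = 0\<^sub>m n l"
    using A B C by - (rule mat_mult_transpose_self_zero[of _ n l], auto)
  then have "(A * B - A * C) $$ (i,j) = 0" if "i < n" "j < l" for i j using that by simp
  then show ?thesis using A B C by (intro eq_matI) auto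
qed

text \<open>If \<open>G\<close> is a generalized inverse of \<open>A\<^sup>T A A\<^sup>T\<close>, then \<open>X = A\<^sup>T G A\<^sup>T\<close> is the pseudoinverse of \<open>A\<close>:
Gram cancellation in \<open>A\<^sup>T A A\<^sup>T G A\<^sup>T A A\<^sup>T = A\<^sup>T A A\<^sup>T\<close> from either side yields \<open>X A A\<^sup>T = A\<^sup>T\<close> and
\<open>A\<^sup>T A X = A\<^sup>T\<close>, and these two equations give all four Penrose conditions.\<close>
lemma pseudoinverse_exists:
  fixes A :: "real Matrix.mat"
  shows "\<exists>X. is_pseudoinverse A X"
proof -
  define n m where "n = dim_row A" and "m = dim_col A"
  have A: "A \<in> carrier_mat n m" by (simp add: n_def m_def)
  define T where "T = transpose_mat A"
  have T: "T \<in> carrier_mat m n" using A by (simp add: T_def)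
  have TT: "transpose_mat T = A" "transpose_mat A = T" by (simp_all add: T_def)
  have K: "T * (A * T) \<in> carrier_mat m n"
    by (rule mult_carrier_mat[OF T mult_carrier_mat[OF A T]])
  obtain G where G: "G \<in> carrier_mat n m" and inv: "T * (A * T) * G * (T * (A * T)) = T * (A * T)"
    using generalized_inverse_exists[OF K] by blast
  define X where "X = T * G * T"
  have X: "X \<in> carrier_mat m n" unfolding X_def by (rule mult_carrier_mat[OF mult_carrier_mat[OF T G] T])
  define X' where "X' = transpose_mat X"
  have X': "X' \<in> carrier_mat n m" using X by (simp add: X'_def)
  note assoc = assoc_mult_mat[where 'a = real]
  have XAT: "X * (A * T) = T"
  proof -
    have 1: "T * (A * (T * (G * (T * (A * T))))) = T * (A * (T * 1\<^sub>m n))"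
      using inv A T G by (simp add: mult_mat_assoc)
    have "A * (T * (G * (T * (A * T)))) = A * (T * 1\<^sub>m n)"
      using gram_cancel_left[OF A, of "T * (G * (T * (A * T)))" n "T * 1\<^sub>m n"] 1 A T G by (simp add: TT)
    then have "T * (G * (T * (A * T))) = T * 1\<^sub>m n"
      using gram_cancel_left[OF T, of "G * (T * (A * T))" n "1\<^sub>m n"] A T G by (simp add: TT)
    then show ?thesis using A T G
      by (simp add: X_def mult_mat_assoc)
  qed
  have TAX: "T * A * X = T"
  proof -
    have "transpose_mat (T * (A * T) * G * (T * (A * T))) = transpose_mat (T * (A * T))" using inv by simp
    then have "A * (T * (A * (transpose_mat G * (A * (T * A))))) = A * (T * (A * 1\<^sub>m m))"
      using A T G by (simp add: transpose_mult_mat TT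
         mult_mat_assoc)
    then have "T * (A * (transpose_mat G * (A * (T * A)))) = T * (A * 1\<^sub>m m)"
      using gram_cancel_left[OF T, of "A * (transpose_mat G * (A * (T * A)))" m "A * 1\<^sub>m m"] A T G by (simp add: TT)
    then have "A * (transpose_mat G * (A * (T * A))) = A * 1\<^sub>m m"
      using gram_cancel_left[OF A, of "transpose_mat G * (A * (T * A))" m "1\<^sub>m m"] A T G by (simp add: TT)
    then have "transpose_mat (A * (transpose_mat G * (A * (T * A)))) = T" using A by (simp add: TT)
    then show ?thesis using A T G
      by (simp add: X_def TT transpose_mult_mat mult_mat_assoc)
  qed
  have XTA: "X' * T * A = A"
    using arg_cong[OF TAX, of transpose_mat] A T X
    by (simp add: TT X'_def transpose_mult_mat mult_mat_assoc)
  have ATX: "A * T * X' = A"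
    using arg_cong[OF XAT, of transpose_mat] A T X
    by (simp add: TT X'_def transpose_mult_mat )
  have tAX: "transpose_mat (A * X) = X' * T" and tXA: "transpose_mat (X * A) = T * X'"
    using A X by (simp_all add: transpose_mult_mat TT X'_def)
  \<comment> \<open>A matrix of the form \<open>B\<^sup>T B\<close> is symmetric; this and its mirror image give the two symmetry conditions.\<close>
  have "A * X = X' * T * A * X" using XTA by simp
  also have "\<dots> = X' * T * (A * X)" using A T X X' by (intro assoc[of _ n n _ m _ n]) auto
  also have "\<dots> = transpose_mat (A * X) * (A * X)" by (simp add: tAX)
  finally have AX: "A * X = transpose_mat (A * X) * (A * X)" .
  have symAX: "transpose_mat (A * X) = A * X"
  proof -
    have "transpose_mat (transpose_mat (A * X) * (A * X)) = transpose_mat (A * X) * (A * X)"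
      using A X by (simp add: transpose_mult_mat )
    then show ?thesis by (simp flip: AX)
  qed
  have "X * A = X * (A * T * X')" using ATX by simp
  also have "\<dots> = X * A * (T * X')" using A T X X'
    by (simp add: mult_mat_assoc)
  finally have XA: "X * A = X * A * transpose_mat (X * A)" by (simp add: tXA)
  have symXA: "transpose_mat (X * A) = X * A"
  proof -
    have "transpose_mat (X * A * transpose_mat (X * A)) = X * A * transpose_mat (X * A)"
      using A X by (simp add: transpose_mult_mat )
    then show ?thesis by (simp flip: XA)
  qed
  have AXA: "A * X * A = A" using symAX tAX XTA by simp
  have "X * A * X = X * A * (T * (G * T))" using A X T G by (simp add: X_def mult_mat_assoc)
  also have "\<dots> = X * (A * T) * (G * T)" using A X T G
    by (simp add: mult_mat_assoc)
  also have "\<dots> = X" using XAT X_def T G by (simp add: mult_mat_assoc)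
  finally show ?thesis unfolding is_pseudoinverse_def
    using X A AXA symAX symXA by auto
qed

lemma pseudoinverse_unique:
  assumes "is_pseudoinverse A X" "is_pseudoinverse A Y"
  shows "X = Y"
proof -
  define n m where "n = dim_row A" and "m = dim_col A"
  have A: "A \<in> carrier_mat n m" by (simp add: n_def m_def)
  have X: "X \<in> carrier_mat m n" and Y: "Y \<in> carrier_mat m n"
    using assms by (auto simp: is_pseudoinverse_def n_def m_def)
  have x: "A * X * A = A" "X * A * X = X" "transpose_mat (A * X) = A * X" "transpose_mat (X * A) = X * A"
    and y: "A * Y * A = A" "Y * A * Y = Y" "transpose_mat (A * Y) = A * Y" "transpose_mat (Y * A) = Y * A"
    using assms by (auto simp: is_pseudoinverse_def)
  note assoc = assoc_mult_mat[where 'a = real]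
  have "A * X = transpose_mat (A * Y * A * X)" using x y by simp
  also have "A * Y * A * X = A * Y * (A * X)" using A X Y by (intro assoc[of _ n n _ m _ n]) auto
  also have "transpose_mat \<dots> = A * X * (A * Y)" using A X Y x y by (simp add: transpose_mult_mat )
  also have "\<dots> = A * X * A * Y" using A X Y by (intro assoc[of _ n n _ m _ n, symmetric]) auto
  finally have 1: "A * X = A * Y" using x by simp
  have "X * A = transpose_mat (X * (A * Y * A))" using x y by simp
  also have "X * (A * Y * A) = X * A * (Y * A)" using A X Y
    by (simp add: mult_mat_assoc)
  also have "transpose_mat \<dots> = Y * A * (X * A)" using A X Y x y by (simp add: transpose_mult_mat )
  also have "\<dots> = Y * (A * X * A)" using A X Y
    by (simp add: mult_mat_assoc)
  finally have 2: "X * A = Y * A" using x by simp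
  have "X = Y * A * X" using x 2 by simp
  also have "\<dots> = Y * (A * X)" using A X Y by (intro assoc[of _ m n _ m _ n]) auto
  also have "\<dots> = Y * A * Y" using 1 A Y by (simp add: mult_mat_assoc)
  finally show ?thesis using y by simp
qed

lemma is_pseudoinverse_pseudoinverse: "is_pseudoinverse A (pseudoinverse A)"
  unfolding pseudoinverse_def
  by (rule theI') (metis pseudoinverse_exists pseudoinverse_unique)

section \<open>Positive definite matrices and local norms\<close>

lemma positive_definite_symmetric:
  assumes "positive_definite A"
  shows "(A *v u) \<bullet> w = (A *v w) \<bullet> u"
proof -
  have "(A *v u) \<bullet> w = (transpose A *v u) \<bullet> w"
    using assms by (simp add: positive_definite_def)
  also have "\<dots> = u \<bullet> (A *v w)"
    by (metis dot_lmul_matrix transpose_matrix_vector)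
  finally show ?thesis by (simp add: inner_commute)
qed

lemma positive_definite_nonneg: "positive_definite A \<Longrightarrow> 0 \<le> (A *v u) \<bullet> u"
  unfolding positive_definite_def by (cases "u = 0") (auto intro: less_imp_le)

lemma positive_definite_eq_0_iff: "positive_definite A \<Longrightarrow> (A *v u) \<bullet> u = 0 \<longleftrightarrow> u = 0"
  unfolding positive_definite_def by (cases "u = 0") (auto dest: spec[of _ u])

lemma positive_definite_Cauchy_Schwarz:
  assumes A: "positive_definite A"
  shows "\<bar>(A *v u) \<bullet> w\<bar> \<le> sqrt ((A *v u) \<bullet> u) * sqrt ((A *v w) \<bullet> w)"
proof -
  define a b c where "a = (A *v u) \<bullet> u" and "b = (A *v u) \<bullet> w" and "c = (A *v w) \<bullet> w"
  have nn: "0 \<le> a" "0 \<le> c" using A by (simp_all add: a_def c_def positive_definite_nonneg)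
  have "b\<^sup>2 \<le> a * c"
  proof (cases "w = 0")
    case True then show ?thesis by (simp add: b_def c_def)
  next
    case False
    then have c: "0 < c" using A by (simp add: c_def positive_definite_def)
    define t where "t = b / c"
    have "0 \<le> (A *v (u - t *\<^sub>R w)) \<bullet> (u - t *\<^sub>R w)"
      by (rule positive_definite_nonneg[OF A])
    also have "\<dots> = a - 2 * t * b + t\<^sup>2 * c"
      using positive_definite_symmetric[OF A, of w u]
      by (simp add: a_def b_def c_def matrix_vector_mult_diff_distrib matrix_vector_mult_scaleR
          inner_diff_left inner_diff_right power2_eq_square algebra_simps)
    also have "\<dots> = a - b\<^sup>2 / c"
      using c by (simp add: t_def power2_eq_square field_simps)
    finally show ?thesis using c by (simp add: field_simps)
  qed
  then have "\<bar>b\<bar> \<le> sqrt (a * c)" by (metis real_sqrt_abs real_sqrt_le_iff)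
  then show ?thesis by (simp add: a_def b_def c_def real_sqrt_mult)
qed

lemma positive_definite_matrix_inv:
  assumes A: "positive_definite A"
  shows "A *v (matrix_inv A *v g) = g"
proof -
  have "inj ((*v) A)"
  proof (rule injI)
    fix u v assume "A *v u = A *v v"
    then have "(A *v (u - v)) \<bullet> (u - v) = 0" by (simp add: matrix_vector_mult_diff_distrib)
    then show "u = v" using positive_definite_eq_0_iff[OF A, of "u - v"] by simp
  qed
  then have "invertible A"
    using matrix_left_invertible_injective invertible_left_inverse by blast
  then have "A ** matrix_inv A = Finite_Cartesian_Product.mat 1"
    unfolding invertible_def matrix_inv_def by (rule someI2_ex) simp
  then show ?thesis by (simp add: matrix_vector_mul_assoc)
qed

lemma local_norm_nonneg: "positive_definite (hessian f x) \<Longrightarrow> 0 \<le> local_norm f x h"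
  by (simp add: local_norm_def positive_definite_nonneg)

lemma local_norm_power2:
  "positive_definite (hessian f x) \<Longrightarrow> (local_norm f x h)\<^sup>2 = (hessian f x *v h) \<bullet> h"
  by (simp add: local_norm_def positive_definite_nonneg)

lemma local_norm_scaleR: "local_norm f x (c *\<^sub>R h) = \<bar>c\<bar> * local_norm f x h"
proof -
  have "(hessian f x *v (c *\<^sub>R h)) \<bullet> (c *\<^sub>R h) = c\<^sup>2 * ((hessian f x *v h) \<bullet> h)"
    by (simp add: matrix_vector_mult_scaleR power2_eq_square)
  then show ?thesis by (simp add: local_norm_def real_sqrt_mult)
qed

text \<open>With \<open>u = H z\<close> the dual norm of \<open>u\<close> is the local norm of \<open>z\<close>, and the Cauchy-Schwarz inequality for
\<open>H\<close> applies to \<open>z\<close> and \<open>w\<close>.\<close>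
lemma dual_norm_Cauchy_Schwarz:
  assumes "positive_definite (hessian f x)"
  shows "\<bar>u \<bullet> w\<bar> \<le> dual_norm f x u * local_norm f x w"
proof -
  define z where "z = matrix_inv (hessian f x) *v u"
  have u: "u = hessian f x *v z" using positive_definite_matrix_inv[OF assms] by (simp add: z_def)
  have "dual_norm f x u = sqrt ((hessian f x *v z) \<bullet> z)"
    unfolding dual_norm_def z_def[symmetric] by (simp add: u)
  then show ?thesis
    using positive_definite_Cauchy_Schwarz[OF assms, of z w] by (simp add: local_norm_def u)
qed

section \<open>The sketched Newton direction\<close>

lemma sketch_apply_in_span: "sketch_apply S u \<in> span (set S)"
  unfolding sketch_apply_def by (intro span_sum span_scale span_base) simp

lemma scalar_prod_sketch_adjoint:
  assumes "u \<in> carrier_vec (length S)"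
  shows "scalar_prod u (sketch_adjoint S g) = sketch_apply S u \<bullet> g"
  using assms
  by (simp add: scalar_prod_def sketch_adjoint_def sketch_apply_def inner_sum_left atLeast0LessThan)

lemma sketched_hessian_mult_vec:
  assumes "u \<in> carrier_vec (length S)"
  shows "sketched_hessian f S x *\<^sub>v u = sketch_adjoint S (hessian f x *v sketch_apply S u)"
proof (rule eq_vecI)
  fix i assume "i < dim_vec (sketch_adjoint S (hessian f x *v sketch_apply S u))"
  then have i: "i < length S" by (simp add: sketch_adjoint_def)
  have "vec_index (sketched_hessian f S x *\<^sub>v u) i
      = (\<Sum>j<length S. S ! i \<bullet> (hessian f x *v S ! j) * vec_index u j)"
    using i assms by (simp add: sketched_hessian_def scalar_prod_def atLeast0LessThan)
  also have "\<dots> = S ! i \<bullet> (hessian f x *v sketch_apply S u)"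
    by (simp add: sketch_apply_def linear_sum[OF matrix_vector_mul_linear] inner_sum_right
        matrix_vector_mult_scaleR mult.commute)
  finally show "vec_index (sketched_hessian f S x *\<^sub>v u) i =
      vec_index (sketch_adjoint S (hessian f x *v sketch_apply S u)) i"
    using i by (simp add: sketch_adjoint_def)
qed (simp add: sketched_hessian_def sketch_adjoint_def)

text \<open>The right-hand side \<open>g\<close> is arbitrary, since both the step (\<open>g\<close> the gradient) and the projection
\<open>P_x h\<close> (\<open>g = H h\<close>) are instances.\<close>
definition newton_direction ::
    "(real^'d \<Rightarrow> real) \<Rightarrow> 'd sketch \<Rightarrow> real^('d::finite) \<Rightarrow> real^'d \<Rightarrow> real^'d" where
  "newton_direction f S x g =
     sketch_apply S (pseudoinverse (sketched_hessian f S x) *\<^sub>v sketch_adjoint S g)"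

lemma newton_direction_in_span: "newton_direction f S x g \<in> span (set S)"
  unfolding newton_direction_def by (rule sketch_apply_in_span)

text \<open>\<open>S\<^sup>T g\<close> lies in the range of \<open>A = S\<^sup>T H S\<close>, so the pseudoinverse solves the system exactly.  To see it, let
\<open>r = A X s - s\<close> be the residual for \<open>s = S\<^sup>T g\<close>.  Then \<open>A r = 0\<close>, hence \<open>S r = 0\<close> as \<open>H\<close> is positive definite, and so
\<open>r\<close> is orthogonal to \<open>A X s\<close> and to \<open>s\<close>, that is, to itself.\<close>
lemma sketched_normal_equations:
  assumes H: "positive_definite (hessian f x)"
  shows "sketch_adjoint S (hessian f x *v newton_direction f S x g) = sketch_adjoint S g"
proof -
  define n A X s where "n = length S" and "A = sketched_hessian f S x"
    and "X = pseudoinverse A" and "s = sketch_adjoint S g"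
  have A: "A \<in> carrier_mat n n" by (simp add: A_def n_def sketched_hessian_def)
  have s: "s \<in> carrier_vec n" by (simp add: s_def sketch_adjoint_def n_def)
  have "is_pseudoinverse A X" unfolding X_def by (rule is_pseudoinverse_pseudoinverse)
  then have X: "X \<in> carrier_mat n n" and AXA: "A * X * A = A" and AX: "transpose_mat (A * X) = A * X"
    using A by (auto simp: is_pseudoinverse_def)
  have symA: "transpose_mat A = A"
    using positive_definite_symmetric[OF H]
    by (intro eq_matI) (auto simp: A_def sketched_hessian_def inner_commute)
  have AAX: "A * (A * X) = A"
    using arg_cong[OF AXA, of transpose_mat] A X by (simp add: transpose_mult_mat[of "A * X" A] AX symA)
  define Xs where "Xs = X *\<^sub>v s"
  have Xs: "Xs \<in> carrier_vec n" using X s by (simp add: Xs_def)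
  define r where "r = A *\<^sub>v Xs - s"
  have r: "r \<in> carrier_vec n" using A X s Xs by (simp add: r_def)
  have q: "newton_direction f S x g = sketch_apply S Xs"
    by (simp add: newton_direction_def Xs_def X_def A_def s_def)
  have As: "A *\<^sub>v (A *\<^sub>v Xs) = A *\<^sub>v s"
    using assoc_mult_mat_vec[OF A X s] assoc_mult_mat_vec[OF A mult_carrier_mat[OF A X] s]
    by (simp add: Xs_def AAX)
  have "A *\<^sub>v r = A *\<^sub>v (A *\<^sub>v Xs) - A *\<^sub>v s"
    unfolding r_def by (rule mult_minus_distrib_mat_vec[OF A mult_mat_vec_carrier[OF A Xs] s])
  then have Ar: "A *\<^sub>v r = 0\<^sub>v n" using As A s by simp
  have "(hessian f x *v sketch_apply S r) \<bullet> sketch_apply S r = scalar_prod r (A *\<^sub>v r)"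
    using r by (simp add: A_def n_def sketched_hessian_mult_vec scalar_prod_sketch_adjoint inner_commute)
  also have "\<dots> = 0" using r by (simp add: Ar)
  finally have Sr: "sketch_apply S r = 0" using positive_definite_eq_0_iff[OF H] by blast
  have rr: "scalar_prod r r = scalar_prod r (A *\<^sub>v Xs) - scalar_prod r s"
    using scalar_prod_minus_distrib[OF r mult_mat_vec_carrier[OF A Xs] s] by (simp add: r_def)
  also have "scalar_prod r (A *\<^sub>v Xs) = sketch_apply S r \<bullet> (hessian f x *v sketch_apply S Xs)"
    using r Xs by (simp add: A_def n_def sketched_hessian_mult_vec scalar_prod_sketch_adjoint)
  also have "scalar_prod r s = sketch_apply S r \<bullet> g"
    using r by (simp add: s_def n_def scalar_prod_sketch_adjoint)
  finally have "scalar_prod r r = 0" by (simp add: Sr)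
  then have "(\<Sum>i<n. (vec_index r i)\<^sup>2) = 0" using r by (simp add: scalar_prod_def atLeast0LessThan power2_eq_square)
  then have r0: "vec_index r i = 0" if "i < n" for i using that by (simp add: sum_nonneg_eq_0_iff)
  have "A *\<^sub>v Xs = s"
  proof (rule eq_vecI)
    fix i assume "i < dim_vec s"
    then show "vec_index (A *\<^sub>v Xs) i = vec_index s i"
      using r0[of i] A Xs s by (simp add: r_def)
  qed (use A s in simp)
  then show ?thesis using Xs q
    by (simp add: A_def n_def s_def sketched_hessian_mult_vec)
qed

text \<open>From here on only this characterisation and its uniqueness are needed, and the matrices of
variable size disappear.\<close>
lemma newton_direction_Galerkin:
  assumes H: "positive_definite (hessian f x)" and "u \<in> span (set S)"
  shows "u \<bullet> (hessian f x *v newton_direction f S x g) = u \<bullet> g"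
  using assms(2)
proof (induction rule: span_induct_alt)
  case (step c v y)
  from \<open>v \<in> set S\<close> obtain i where i: "i < length S" "v = S ! i" by (metis in_set_conv_nth)
  have "vec_index (sketch_adjoint S (hessian f x *v newton_direction f S x g)) i = vec_index (sketch_adjoint S g) i"
    using sketched_normal_equations[OF H] by metis
  then have "v \<bullet> (hessian f x *v newton_direction f S x g) = v \<bullet> g"
    using i by (simp add: sketch_adjoint_def)
  then show ?case using step by (simp add: inner_add_left)
qed simp

lemma newton_direction_unique:
  assumes H: "positive_definite (hessian f x)" and q: "q \<in> span (set S)"
    and eq: "\<And>u. u \<in> span (set S) \<Longrightarrow> u \<bullet> (hessian f x *v q) = u \<bullet> g"
  shows "newton_direction f S x g = q"
proof -
  let ?e = "newton_direction f S x g - q"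
  have e: "?e \<in> span (set S)" using newton_direction_in_span q by (rule span_diff)
  have "(hessian f x *v ?e) \<bullet> ?e
      = ?e \<bullet> (hessian f x *v newton_direction f S x g) - ?e \<bullet> (hessian f x *v q)"
    by (subst inner_commute) (simp only: matrix_vector_mult_diff_distrib inner_diff_right)
  also have "\<dots> = 0" using eq[OF e] newton_direction_Galerkin[OF H e, of g] by simp
  finally show ?thesis using positive_definite_eq_0_iff[OF H] by force
qed

lemma linear_newton_direction:
  fixes x :: "real^('d::finite)"
  assumes H: "positive_definite (hessian f x)"
  shows "linear (newton_direction f S x)"
proof (rule linearI)
  fix a b :: "real^'d" and c :: real
  show "newton_direction f S x (a + b) = newton_direction f S x a + newton_direction f S x b"
    by (rule newton_direction_unique[OF H span_add[OF newton_direction_in_span newton_direction_in_span]])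
      (simp only: matrix_vector_right_distrib inner_add_right newton_direction_Galerkin[OF H])
  show "newton_direction f S x (c *\<^sub>R a) = c *\<^sub>R newton_direction f S x a"
    by (rule newton_direction_unique[OF H span_scale[OF newton_direction_in_span]])
      (simp only: matrix_vector_mult_scaleR inner_scaleR_right newton_direction_Galerkin[OF H])
qed

lemma projection_mult_vec:
  assumes H: "positive_definite (hessian f x)"
  shows "projection f x S *v h = newton_direction f S x (hessian f x *v h)"
proof -
  have "projection f x S = matrix (newton_direction f S x \<circ> (*v) (hessian f x))"
    by (simp add: projection_def newton_direction_def comp_def)
  moreover have "linear (newton_direction f S x \<circ> (*v) (hessian f x))"
    by (intro linear_compose matrix_vector_mul_linear linear_newton_direction H)
  ultimately show ?thesis by (simp add: matrix_works)
qed

text \<open>The dual norm of the sketched gradient, which sets the stepsize, is the local length of the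
full sketched Newton step.\<close>
lemma sketched_dual_norm_eq:
  assumes H: "positive_definite (hessian f x)"
  shows "sketched_dual_norm f x S (sketch_adjoint S g) = local_norm f x (newton_direction f S x g)"
proof -
  let ?q = "newton_direction f S x g" and ?u = "pseudoinverse (sketched_hessian f S x) *\<^sub>v sketch_adjoint S g"
  have u: "?u \<in> carrier_vec (length S)"
    using is_pseudoinverse_pseudoinverse[of "sketched_hessian f S x"]
    by (auto simp: is_pseudoinverse_def sketched_hessian_def sketch_adjoint_def)
  have "scalar_prod (sketch_adjoint S g) ?u = scalar_prod ?u (sketch_adjoint S g)"
    using u by (intro comm_scalar_prod[of _ "length S"]) (auto simp: sketch_adjoint_def)
  also have "\<dots> = ?q \<bullet> g" using u by (simp add: scalar_prod_sketch_adjoint newton_direction_def)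
  also have "\<dots> = ?q \<bullet> (hessian f x *v ?q)"
    by (simp add: newton_direction_Galerkin[OF H newton_direction_in_span])
  finally show ?thesis by (simp add: sketched_dual_norm_def local_norm_def inner_commute)
qed

section \<open>Cubic models and the decrease in one step\<close>

lemma has_derivative_gradient:
  assumes "twice_differentiable f"
  shows "(f has_derivative (\<lambda>h. h \<bullet> gradient f x)) (at x)"
proof -
  obtain f' where f': "(f has_derivative f') (at x)"
    using assms by (auto simp: twice_differentiable_def differentiable_def)
  have "f' = (\<lambda>h. h \<bullet> adjoint f' 1)"
    using adjoint_works[OF has_derivative_linear[OF f'], of _ 1] by (simp add: fun_eq_iff)
  then have ex: "GDERIV f x :> adjoint f' 1" using f' by (simp add: gderiv_def)
  have "g = adjoint f' 1" if "GDERIV f x :> g" for g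
  proof -
    have "(\<lambda>h. h \<bullet> g) = (\<lambda>h. h \<bullet> adjoint f' 1)"
      using has_derivative_unique that ex unfolding gderiv_def by blast
    then show ?thesis by (simp add: fun_eq_iff vector_eq_ldot)
  qed
  then have "gradient f x = adjoint f' 1" unfolding gradient_def using ex by (intro the_equality)
  then show ?thesis using ex by (simp add: gderiv_def)
qed

lemma gradient_has_derivative_hessian:
  assumes "twice_differentiable f"
  shows "(gradient f has_derivative (\<lambda>h. hessian f x *v h)) (at x)"
proof -
  have d: "(gradient f has_derivative frechet_derivative (gradient f) (at x)) (at x)"
    using assms by (simp add: twice_differentiable_def frechet_derivative_works)
  moreover have "frechet_derivative (gradient f) (at x) = (\<lambda>h. hessian f x *v h)"
    using has_derivative_linear[OF d] by (simp add: hessian_def fun_eq_iff matrix_works)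
  ultimately show ?thesis by simp
qed

text \<open>Subtracting the bounding cubic from \<open>\<phi>\<close> leaves a function with nonpositive second derivative; its
derivative and then the function itself decrease from zero.  The remainder form of the Taylor formula would
only give \<open>K / 2\<close>.\<close>
lemma Taylor_second_order_le:
  fixes \<phi> \<phi>' \<phi>'' :: "real \<Rightarrow> real"
  assumes d1: "\<And>t. (\<phi> has_real_derivative \<phi>' t) (at t)"
    and d2: "\<And>t. (\<phi>' has_real_derivative \<phi>'' t) (at t)"
    and le: "\<And>t. 0 \<le> t \<Longrightarrow> t \<le> 1 \<Longrightarrow> \<phi>'' t \<le> \<phi>'' 0 + K * t"
  shows "\<phi> 1 \<le> \<phi> 0 + \<phi>' 0 + \<phi>'' 0 / 2 + K / 6"
proof -
  define \<psi>' where "\<psi>' t = \<phi>' t - \<phi>' 0 - t * \<phi>'' 0 - K * t^2 / 2" for t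
  define \<psi> where "\<psi> t = \<phi> t - \<phi> 0 - t * \<phi>' 0 - t^2 * \<phi>'' 0 / 2 - K * t^3 / 6" for t
  have D1: "(\<psi> has_real_derivative \<psi>' t) (at t)" for t
    unfolding \<psi>_def \<psi>'_def by (auto intro!: derivative_eq_intros d1 simp: power2_eq_square)
  have D2: "(\<psi>' has_real_derivative \<phi>'' t - \<phi>'' 0 - K * t) (at t)" for t
    unfolding \<psi>'_def by (auto intro!: derivative_eq_intros d2)
  have "\<psi>' t \<le> 0" if "0 \<le> t" "t \<le> 1" for t
  proof -
    have "\<psi>' t \<le> \<psi>' 0"
      using that D2 le by (intro DERIV_nonpos_imp_nonincreasing[of 0 t]) (force simp: algebra_simps)+
    then show ?thesis by (simp add: \<psi>'_def)
  qed
  then have "\<psi> 1 \<le> \<psi> 0"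
    using D1 by (intro DERIV_nonpos_imp_nonincreasing[of 0 1]) auto
  then show ?thesis by (simp add: \<psi>_def)
qed

locale self_concordant_function =
  fixes f :: "real^('d::finite) \<Rightarrow> real" and L :: real
  assumes twice_differentiable: "twice_differentiable f"
    and positive_definite_hessian: "positive_definite (hessian f x)"
    and self_concordant: "semi_strongly_self_concordant L f"
begin

lemma hessian_difference_bound:
  "\<bar>((hessian f y - hessian f x) *v v) \<bullet> v\<bar> \<le> L * local_norm f x (y - x) * (local_norm f x v)\<^sup>2"
proof (cases "v = 0")
  case True
  then show ?thesis by (simp add: local_norm_def)
next
  case False
  let ?u = "(hessian f y - hessian f x) *v v"
  have pos: "0 < local_norm f x v"
    using False positive_definite_hessian[of x] by (simp add: local_norm_def positive_definite_def)
  have "ereal (dual_norm f x ?u / local_norm f x v)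
      \<le> (SUP v\<in>{v. v \<noteq> 0}. ereal (dual_norm f x ((hessian f y - hessian f x) *v v) / local_norm f x v))"
    using False by (intro SUP_upper) simp
  also have "\<dots> \<le> ereal (L * local_norm f x (y - x))"
    using self_concordant by (simp add: semi_strongly_self_concordant_def)
  finally have "dual_norm f x ?u \<le> L * local_norm f x (y - x) * local_norm f x v"
    using pos by (simp add: pos_divide_le_eq)
  then have "dual_norm f x ?u * local_norm f x v
      \<le> L * local_norm f x (y - x) * local_norm f x v * local_norm f x v"
    using pos by (intro mult_right_mono) auto
  then show ?thesis
    using dual_norm_Cauchy_Schwarz[OF positive_definite_hessian, of ?u v x]
    by (simp add: power2_eq_square mult.assoc)
qed

lemma derivative_along_line:
  "((\<lambda>t. f (x + t *\<^sub>R h)) has_real_derivative h \<bullet> gradient f (x + t *\<^sub>R h)) (at t)"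
proof -
  have "((\<lambda>t. f (x + t *\<^sub>R h)) has_derivative (\<lambda>s. (s *\<^sub>R h) \<bullet> gradient f (x + t *\<^sub>R h))) (at t)"
    by (rule has_derivative_compose[OF _ has_derivative_gradient[OF twice_differentiable]])
      (auto intro!: derivative_eq_intros)
  then show ?thesis by (simp add: has_field_derivative_def mult.commute[of _ "h \<bullet> _"])
qed

lemma second_derivative_along_line:
  "((\<lambda>t. u \<bullet> gradient f (x + t *\<^sub>R h)) has_real_derivative
     (hessian f (x + t *\<^sub>R h) *v h) \<bullet> u) (at t)"
proof -
  have "((\<lambda>t. gradient f (x + t *\<^sub>R h)) has_derivative (\<lambda>s. hessian f (x + t *\<^sub>R h) *v (s *\<^sub>R h))) (at t)"
    by (rule has_derivative_compose[OF _ gradient_has_derivative_hessian[OF twice_differentiable]])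
      (auto intro!: derivative_eq_intros)
  then have "((\<lambda>t. u \<bullet> gradient f (x + t *\<^sub>R h)) has_derivative
      (\<lambda>s. u \<bullet> (hessian f (x + t *\<^sub>R h) *v (s *\<^sub>R h)))) (at t)"
    by (rule has_derivative_inner_right)
  then show ?thesis
    by (simp add: has_field_derivative_def matrix_vector_mult_scaleR inner_commute[of u] mult.commute[of _ "_ \<bullet> _"])
qed

lemma hessian_difference_along_line:
  assumes "0 \<le> t"
  shows "\<bar>(hessian f (x + t *\<^sub>R h) *v h) \<bullet> h - (hessian f x *v h) \<bullet> h\<bar> \<le> L * local_norm f x h ^ 3 * t"
  using hessian_difference_bound[of "x + t *\<^sub>R h" x h] assms
  by (simp add: matrix_vector_mult_diff_rdistrib inner_diff_left local_norm_scaleR power3_eq_cube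
      power2_eq_square mult_ac)

lemma cubic_upper_model:
  "f (x + h) \<le> f x + h \<bullet> gradient f x + (local_norm f x h)\<^sup>2 / 2 + L / 6 * local_norm f x h ^ 3"
proof -
  have "f (x + 1 *\<^sub>R h) \<le> f (x + 0 *\<^sub>R h) + h \<bullet> gradient f (x + 0 *\<^sub>R h)
      + (hessian f (x + 0 *\<^sub>R h) *v h) \<bullet> h / 2 + L * local_norm f x h ^ 3 / 6"
    using hessian_difference_along_line[of _ x h]
    by (intro Taylor_second_order_le[OF derivative_along_line second_derivative_along_line])
      (fastforce simp: abs_le_iff)
  then show ?thesis by (simp add: local_norm_power2[OF positive_definite_hessian])
qed

lemma cubic_lower_model:
  "f (x + h) \<ge> f x + h \<bullet> gradient f x + (local_norm f x h)\<^sup>2 / 2 - L / 6 * local_norm f x h ^ 3"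
proof -
  have "- f (x + 1 *\<^sub>R h) \<le> - f (x + 0 *\<^sub>R h) + - (h \<bullet> gradient f (x + 0 *\<^sub>R h))
      + - ((hessian f (x + 0 *\<^sub>R h) *v h) \<bullet> h) / 2 + L * local_norm f x h ^ 3 / 6"
    using hessian_difference_along_line[of _ x h]
    by (intro Taylor_second_order_le[OF DERIV_minus[OF derivative_along_line]
          DERIV_minus[OF second_derivative_along_line]])
      (fastforce simp: abs_le_iff)
  then show ?thesis by (simp add: local_norm_power2[OF positive_definite_hessian])
qed

end

text \<open>The cubic model on a ray of steepest descent, as a function of the length \<open>r\<close>.  The condition on
\<open>r0\<close> says that its derivative vanishes there, and the increment from \<open>r0\<close> to \<open>r\<close> is
\<open>(r - r0)^2 * (1 / 2 + L / 6 * (r + 2 * r0))\<close>.\<close>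
lemma cubic_model_min:
  fixes n r r0 L :: real
  assumes "r0 + L * r0\<^sup>2 / 2 = n" "0 \<le> r" "0 \<le> r0" "0 \<le> L"
  shows "- r0 * n + r0\<^sup>2 / 2 + L / 6 * r0 ^ 3 \<le> - r * n + r\<^sup>2 / 2 + L / 6 * r ^ 3"
proof -
  have "0 \<le> (r - r0)\<^sup>2 / 2 + L / 6 * ((r - r0)\<^sup>2 * (r + 2 * r0))" using assms by simp
  also have "\<dots> = (- r * n + r\<^sup>2 / 2 + L / 6 * r ^ 3) - (- r0 * n + r0\<^sup>2 / 2 + L / 6 * r0 ^ 3)"
    unfolding assms(1)[symmetric] by (simp add: field_simps power2_eq_square power3_eq_cube)
  finally show ?thesis by simp
qed

text \<open>The stepsize formula solves a quadratic equation; its value 1 at \<open>G = 0\<close> is the continuous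
extension.\<close>
lemma damped_step_length:
  fixes G :: real
  assumes "0 \<le> G"
  defines "a \<equiv> (if G = 0 then 1 else (-1 + sqrt (1 + 2 * G)) / G)"
  shows "0 \<le> a" "a + G * a\<^sup>2 / 2 = 1"
proof -
  have "(1 + G * a)\<^sup>2 = 1 + 2 * G" and a: "0 \<le> a" using assms by (auto simp: a_def)
  then have "G * (a + G * a\<^sup>2 / 2) = G * 1" by (simp add: power2_eq_square algebra_simps)
  then show "a + G * a\<^sup>2 / 2 = 1" by (cases "G = 0") (auto simp: a_def)
  show "0 \<le> a" by (rule a)
qed

definition sketched_newton ::
    "(real^'d \<Rightarrow> real) \<Rightarrow> 'd sketch \<Rightarrow> real^('d::finite) \<Rightarrow> real^'d" where
  "sketched_newton f S x = newton_direction f S x (gradient f x)"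

lemma sgn_step_eq:
  fixes f S x L
  assumes "positive_definite (hessian f x)"
  defines "G \<equiv> L * local_norm f x (sketched_newton f S x)"
  shows "sgn_step L f S x = x - (if G = 0 then 1 else (-1 + sqrt (1 + 2 * G)) / G) *\<^sub>R sketched_newton f S x"
proof -
  have "sgn_G L f S x = G"
    using sketched_dual_norm_eq[OF assms(1)]
    by (simp add: sgn_G_def sketched_gradient_def G_def sketched_newton_def)
  then show ?thesis
    by (simp add: sgn_step_def sgn_stepsize_def sketched_newton_def newton_direction_def sketched_gradient_def Let_def)
qed

context self_concordant_function
begin

text \<open>The step has local length \<open>r0 = a n\<close>, where the stepsize equation is the stationarity condition of
\<open>cubic_model_min\<close>.  Among vectors \<open>w\<close> of given length in the range of the sketch the linear term is smallest
along \<open>- q\<close>, because \<open>w \<bullet> g = w \<bullet> H q\<close>; so the scalar minimum is the minimum over the whole range.\<close>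
lemma sgn_step_le_model:
  assumes La: "L \<le> La" "0 \<le> La" and w: "w \<in> span (set S)"
  shows "f (sgn_step La f S x)
    \<le> f x + w \<bullet> gradient f x + (local_norm f x w)\<^sup>2 / 2 + La / 6 * local_norm f x w ^ 3"
proof -
  note pd = positive_definite_hessian
  define q n where "q = sketched_newton f S x" and "n = local_norm f x q"
  define a where "a = (if La * n = 0 then 1 else (-1 + sqrt (1 + 2 * (La * n))) / (La * n))"
  have n: "0 \<le> n" by (simp add: n_def local_norm_nonneg pd)
  have a: "0 \<le> a" "a + La * n * a\<^sup>2 / 2 = 1"
    using damped_step_length[of "La * n"] n La by (simp_all add: a_def)
  define r0 where "r0 = a * n"
  have r0: "0 \<le> r0" using a n by (simp add: r0_def)
  have "r0 + La * r0\<^sup>2 / 2 = n * (a + La * n * a\<^sup>2 / 2)"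
    by (simp add: r0_def power2_eq_square algebra_simps)
  then have r0n: "r0 + La * r0\<^sup>2 / 2 = n" using a by simp
  have q: "u \<bullet> (hessian f x *v q) = u \<bullet> gradient f x" if "u \<in> span (set S)" for u
    using that by (simp add: q_def sketched_newton_def newton_direction_Galerkin pd)
  have "q \<bullet> gradient f x = n\<^sup>2"
    using q[of q] newton_direction_in_span[of f S x]
    by (simp add: q_def sketched_newton_def n_def local_norm_power2 pd inner_commute)
  moreover have "local_norm f x (- (a *\<^sub>R q)) = r0"
    using a local_norm_scaleR[of f x "- a" q] by (simp add: r0_def n_def)
  moreover have "sgn_step La f S x = x - a *\<^sub>R q"
    unfolding sgn_step_eq[OF pd] a_def n_def q_def ..
  ultimately have "f (sgn_step La f S x) \<le> f x + (- r0 * n + r0\<^sup>2 / 2 + L / 6 * r0 ^ 3)"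
    using cubic_upper_model[of x "- (a *\<^sub>R q)"] by (simp add: r0_def power2_eq_square)
  also have "\<dots> \<le> f x + (- r0 * n + r0\<^sup>2 / 2 + La / 6 * r0 ^ 3)"
    using La r0 by (simp add: mult_right_mono)
  also have "\<dots> \<le> f x + (- local_norm f x w * n + (local_norm f x w)\<^sup>2 / 2 + La / 6 * local_norm f x w ^ 3)"
    using cubic_model_min[OF r0n _ r0 La(2), of "local_norm f x w"] by (simp add: local_norm_nonneg pd)
  also have "- local_norm f x w * n \<le> w \<bullet> gradient f x"
    using positive_definite_Cauchy_Schwarz[OF pd, of x q w] q[OF w]
    by (simp add: n_def local_norm_def inner_commute mult.commute abs_le_iff)
  finally show ?thesis by simp
qed

lemma sgn_step_descent:
  assumes "L \<le> La" "0 \<le> La"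
  shows "f (sgn_step La f S x) \<le> f x"
  using sgn_step_le_model[OF assms span_0, of S x] by (simp add: local_norm_def)

end

section \<open>Measurability of the step\<close>

lemma borel_measurable_vec_componentwise:
  fixes F :: "'a \<Rightarrow> real^('d::finite)"
  assumes "\<And>i. (\<lambda>\<omega>. F \<omega> $ i) \<in> borel_measurable M"
  shows "F \<in> borel_measurable M"
  unfolding borel_measurable_euclidean_space[of F]
  using assms by (auto simp: Basis_vec_def inner_axis)

lemma borel_measurable_vec_nth [measurable (raw)]:
  fixes F :: "'a \<Rightarrow> real^('d::finite)"
  assumes "F \<in> borel_measurable M"
  shows "(\<lambda>\<omega>. F \<omega> $ i) \<in> borel_measurable M"
  using assms by (intro borel_measurable_continuous_on[of "\<lambda>v. v $ i"] continuous_intros)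

lemma borel_measurable_det:
  fixes A :: "'a \<Rightarrow> real^'d^('d::finite)"
  assumes "\<And>i j. (\<lambda>\<omega>. A \<omega> $ i $ j) \<in> borel_measurable M"
  shows "(\<lambda>\<omega>. det (A \<omega>)) \<in> borel_measurable M"
  unfolding det_def using assms by measurable

definition sketch_gram :: "'d sketch \<Rightarrow> real^('d::finite) \<Rightarrow> real^'d" where
  "sketch_gram S h = (\<Sum>i<length S. (S ! i \<bullet> h) *\<^sub>R S ! i)"

lemma linear_sketch_gram: "linear (sketch_gram S)"
  by (rule linearI) (simp_all add: sketch_gram_def inner_add_right scaleR_left_distrib sum.distrib scaleR_sum_right)

text \<open>\<open>S S\<^sup>T h\<close> is measurable in the sketch: for each fixed number of columns it is a finite sum, and
the number of columns is a countable-valued measurable function.\<close>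
lemma borel_measurable_sketch_gram [measurable]:
  assumes "X \<in> measurable M sketch_space" and [measurable]: "Y \<in> borel_measurable M"
  shows "(\<lambda>\<omega>. sketch_gram (X \<omega>) (Y \<omega>)) \<in> borel_measurable M"
proof -
  have len: "(\<lambda>\<omega>. length (X \<omega>)) \<in> measurable M (count_space UNIV)"
    and [measurable]: "\<And>i. (\<lambda>\<omega>. sketch_column (X \<omega>) i) \<in> borel_measurable M"
    using assms(1) by (auto simp: measurable_sketch_space_iff)
  have "(\<lambda>\<omega>. \<Sum>i<length (X \<omega>). (sketch_column (X \<omega>) i \<bullet> Y \<omega>) *\<^sub>R sketch_column (X \<omega>) i) \<in> borel_measurable M"
    by (rule measurable_compose_countable[OF _ len]) measurable
  then show ?thesis by (simp add: sketch_gram_def sketch_column_def)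
qed

context self_concordant_function
begin

lemma continuous_on_f: "continuous_on UNIV f"
  using has_derivative_continuous[OF has_derivative_gradient[OF twice_differentiable]]
  by (simp add: continuous_on_eq_continuous_at)

lemma borel_measurable_f [measurable]: "f \<in> borel_measurable borel"
  by (rule borel_measurable_continuous_onI[OF continuous_on_f])

lemma borel_measurable_gradient [measurable]: "gradient f \<in> borel_measurable borel"
proof (rule borel_measurable_continuous_onI)
  show "continuous_on UNIV (gradient f)"
    using has_derivative_continuous[OF gradient_has_derivative_hessian[OF twice_differentiable]]
    by (simp add: continuous_on_eq_continuous_at)
qed

text \<open>The Hessian is a pointwise limit of difference quotients of the continuous gradient.\<close>
lemma borel_measurable_hessian [measurable]: "(\<lambda>x. hessian f x *v v) \<in> borel_measurable borel"
proof (rule borel_measurable_vec_componentwise)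
  fix i
  let ?u = "axis i 1 :: real^'d"
  define t where "t n = inverse (real (Suc n))" for n
  have t: "filterlim t (at 0) sequentially"
    unfolding t_def using LIMSEQ_inverse_real_of_nat by (intro filterlim_atI) auto
  have "(\<lambda>n. (?u \<bullet> gradient f (x + t n *\<^sub>R v) - ?u \<bullet> gradient f x) / t n) \<longlonglongrightarrow> (hessian f x *v v) $ i" for x
  proof -
    have "((\<lambda>h. (?u \<bullet> gradient f (x + h *\<^sub>R v) - ?u \<bullet> gradient f x) / h) \<longlongrightarrow> (hessian f x *v v) \<bullet> ?u) (at 0)"
      using second_derivative_along_line[of ?u x v 0] by (simp add: DERIV_def)
    from filterlim_compose[OF this t] show ?thesis by (simp add: inner_axis)
  qed
  then show "(\<lambda>x. (hessian f x *v v) $ i) \<in> borel_measurable borel"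
    by (rule borel_measurable_LIMSEQ_metric[rotated]) measurable
qed

text \<open>The system \<open>(\<epsilon> I + S S\<^sup>T H) z = S S\<^sup>T g\<close> is the push-through form of
\<open>z = S (\<epsilon> I + S\<^sup>T H S)\<^sup>-\<^sup>1 S\<^sup>T g\<close>.  It has the fixed size \<open>d\<close>, so that its solution can be written with determinants.\<close>
definition ridge_matrix :: "real \<Rightarrow> 'd sketch \<Rightarrow> real^'d \<Rightarrow> real^'d^'d" where
  "ridge_matrix \<epsilon> S x = matrix (\<lambda>h. \<epsilon> *\<^sub>R h + sketch_gram S (hessian f x *v h))"

definition ridge_newton :: "real \<Rightarrow> 'd sketch \<Rightarrow> real^'d \<Rightarrow> real^'d" where
  "ridge_newton \<epsilon> S x =
     (\<chi> k. det (\<chi> i j. if j = k then sketch_gram S (gradient f x) $ i else ridge_matrix \<epsilon> S x $ i $ j)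
       / det (ridge_matrix \<epsilon> S x))"

lemma ridge_matrix_mult: "ridge_matrix \<epsilon> S x *v h = \<epsilon> *\<^sub>R h + sketch_gram S (hessian f x *v h)"
proof -
  have "linear (\<lambda>h. \<epsilon> *\<^sub>R h + sketch_gram S (hessian f x *v h))"
    by (intro linear_compose_add linear_compose_scale_right linear_ident
        linear_compose[OF matrix_vector_mul_linear linear_sketch_gram, unfolded comp_def])
  then show ?thesis by (simp add: ridge_matrix_def matrix_works)
qed

text \<open>The system is regular: pairing \<open>\<epsilon> h + S S\<^sup>T H h = 0\<close> with \<open>H h\<close> gives a sum of two nonnegative terms,
the first of which vanishes only for \<open>h = 0\<close>.\<close>
lemma ridge_newton_equation:
  assumes "0 < \<epsilon>"
  shows "\<epsilon> *\<^sub>R ridge_newton \<epsilon> S x + sketch_gram S (hessian f x *v ridge_newton \<epsilon> S x)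
    = sketch_gram S (gradient f x)"
proof -
  have "h = 0" if "ridge_matrix \<epsilon> S x *v h = 0" for h
  proof -
    let ?Hh = "hessian f x *v h"
    have "0 = \<epsilon> * (?Hh \<bullet> h) + (\<Sum>i<length S. (S ! i \<bullet> ?Hh)\<^sup>2)"
      using arg_cong[OF that, of "\<lambda>v. ?Hh \<bullet> v"]
      by (simp add: ridge_matrix_mult inner_add_right sketch_gram_def inner_sum_right
          power2_eq_square inner_commute)
    moreover have "0 \<le> \<epsilon> * (?Hh \<bullet> h)" "0 \<le> (\<Sum>i<length S. (S ! i \<bullet> ?Hh)\<^sup>2)"
      using assms by (auto simp: positive_definite_nonneg positive_definite_hessian intro: sum_nonneg)
    ultimately have "\<epsilon> * (?Hh \<bullet> h) = 0" by linarith
    then show ?thesis using assms positive_definite_eq_0_iff[OF positive_definite_hessian, of x h] by simp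
  qed
  then have "det (ridge_matrix \<epsilon> S x) \<noteq> 0"
    using matrix_left_invertible_ker[of "ridge_matrix \<epsilon> S x"] invertible_left_inverse[of "ridge_matrix \<epsilon> S x"]
      invertible_det_nz[of "ridge_matrix \<epsilon> S x"] by blast
  from cramer[OF this] show ?thesis
    by (simp add: ridge_newton_def flip: ridge_matrix_mult)
qed

text \<open>Write \<open>q = S u\<close>.  The error \<open>e\<close> satisfies \<open>\<epsilon> e + S S\<^sup>T H e = - \<epsilon> S u\<close>, hence \<open>e = S w\<close> with
\<open>S\<^sup>T H e = - \<epsilon> (w + u)\<close>, and \<open>e \<bullet> H e = - \<epsilon> w \<bullet> (w + u) \<le> \<epsilon> (u \<bullet> u) / 4\<close> by completing the square.\<close>
lemma ridge_newton_error:
  "\<exists>C. \<forall>\<epsilon>>0. (local_norm f x (ridge_newton \<epsilon> S x - sketched_newton f S x))\<^sup>2 \<le> \<epsilon> * C"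
proof -
  note pd = positive_definite_hessian
  define q where "q = sketched_newton f S x"
  define u where "u = vec_index (pseudoinverse (sketched_hessian f S x) *\<^sub>v sketch_adjoint S (gradient f x))"
  have q: "q = (\<Sum>i<length S. u i *\<^sub>R S ! i)"
    by (simp add: q_def sketched_newton_def newton_direction_def sketch_apply_def u_def)
  have "S ! i \<bullet> (hessian f x *v q) = S ! i \<bullet> gradient f x" if "i < length S" for i
    unfolding q_def sketched_newton_def
    using that by (intro newton_direction_Galerkin pd span_base) simp
  then have gram_q: "sketch_gram S (hessian f x *v q) = sketch_gram S (gradient f x)"
    by (simp add: sketch_gram_def)
  have "(local_norm f x (ridge_newton \<epsilon> S x - q))\<^sup>2 \<le> \<epsilon> * (\<Sum>i<length S. (u i)\<^sup>2 / 4)" if "0 < \<epsilon>" for \<epsilon>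
  proof -
    define e where "e = ridge_newton \<epsilon> S x - q"
    define w where "w i = - (S ! i \<bullet> (hessian f x *v e)) / \<epsilon> - u i" for i
    have "\<epsilon> *\<^sub>R ridge_newton \<epsilon> S x
        = sketch_gram S (gradient f x) - sketch_gram S (hessian f x *v ridge_newton \<epsilon> S x)"
      using ridge_newton_equation[OF that, of S x] by (simp only: eq_diff_eq)
    then have e1: "\<epsilon> *\<^sub>R e = - sketch_gram S (hessian f x *v e) - \<epsilon> *\<^sub>R q"
      by (simp add: e_def matrix_vector_mult_diff_distrib linear_diff[OF linear_sketch_gram] gram_q scaleR_diff_right)
    have "\<epsilon> *\<^sub>R e = \<epsilon> *\<^sub>R (\<Sum>i<length S. w i *\<^sub>R S ! i)"
    proof -
      have "\<epsilon> *\<^sub>R (\<Sum>i<length S. w i *\<^sub>R S ! i)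
          = (\<Sum>i<length S. - ((S ! i \<bullet> (hessian f x *v e)) *\<^sub>R S ! i) - \<epsilon> *\<^sub>R (u i *\<^sub>R S ! i))"
        unfolding scaleR_sum_right using that
        by (intro sum.cong) (simp_all add: w_def algebra_simps)
      also have "\<dots> = - sketch_gram S (hessian f x *v e) - \<epsilon> *\<^sub>R q"
        by (simp add: sum_subtractf sum_negf sketch_gram_def q scaleR_sum_right)
      finally show ?thesis unfolding e1 ..
    qed
    then have e: "e = (\<Sum>i<length S. w i *\<^sub>R S ! i)" using that by simp
    have "(local_norm f x e)\<^sup>2 = (\<Sum>i<length S. w i * (S ! i \<bullet> (hessian f x *v e)))"
      using arg_cong[OF e, of "\<lambda>v. v \<bullet> (hessian f x *v e)"]
      by (simp add: local_norm_power2 pd inner_commute[of "hessian f x *v e"] inner_sum_left)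
    also have "\<dots> \<le> (\<Sum>i<length S. \<epsilon> * ((u i)\<^sup>2 / 4))"
    proof (rule sum_mono)
      fix i
      have s: "S ! i \<bullet> (hessian f x *v e) = - \<epsilon> * (w i + u i)" using that by (simp add: w_def)
      have "0 \<le> \<epsilon> * (w i + u i / 2)\<^sup>2" using that by simp
      then show "w i * (S ! i \<bullet> (hessian f x *v e)) \<le> \<epsilon> * ((u i)\<^sup>2 / 4)"
        unfolding s by (simp add: power2_eq_square algebra_simps)
    qed
    finally show ?thesis by (simp add: e_def sum_distrib_left)
  qed
  then show ?thesis unfolding q_def by blast
qed

lemma ridge_newton_tendsto:
  "(\<lambda>n. ridge_newton (inverse (real (Suc n))) S x $ k) \<longlonglongrightarrow> sketched_newton f S x $ k"
proof -
  note pd = positive_definite_hessian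
  define q where "q = sketched_newton f S x"
  define \<epsilon> where "\<epsilon> n = inverse (real (Suc n))" for n
  obtain C where C: "\<And>e. 0 < e \<Longrightarrow> (local_norm f x (ridge_newton e S x - q))\<^sup>2 \<le> e * C"
    using ridge_newton_error[of x S] by (auto simp: q_def)
  define z where "z = matrix_inv (hessian f x) *v axis k 1"
  have z: "hessian f x *v z = axis k 1" by (simp add: z_def positive_definite_matrix_inv pd)
  have "\<bar>ridge_newton (\<epsilon> n) S x $ k - q $ k\<bar> \<le> local_norm f x z * sqrt (\<epsilon> n * C)" for n
  proof -
    have "\<bar>ridge_newton (\<epsilon> n) S x $ k - q $ k\<bar> = \<bar>(hessian f x *v z) \<bullet> (ridge_newton (\<epsilon> n) S x - q)\<bar>"
      by (simp add: z inner_axis')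
    also have "\<dots> \<le> local_norm f x z * local_norm f x (ridge_newton (\<epsilon> n) S x - q)"
      unfolding local_norm_def by (rule positive_definite_Cauchy_Schwarz[OF pd])
    also have "\<dots> \<le> local_norm f x z * sqrt (\<epsilon> n * C)"
      by (intro mult_left_mono real_le_rsqrt C local_norm_nonneg pd) (simp add: \<epsilon>_def)
    finally show ?thesis .
  qed
  moreover have "(\<lambda>n. local_norm f x z * sqrt (\<epsilon> n * C)) \<longlonglongrightarrow> local_norm f x z * sqrt (0 * C)"
    unfolding \<epsilon>_def by (intro tendsto_intros LIMSEQ_inverse_real_of_nat)
  ultimately have "(\<lambda>n. ridge_newton (\<epsilon> n) S x $ k - q $ k) \<longlonglongrightarrow> 0"
    by - (rule Lim_null_comparison[where g = "\<lambda>n. local_norm f x z * sqrt (\<epsilon> n * C)"], auto)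
  then show ?thesis unfolding q_def \<epsilon>_def by (rule LIM_zero_cancel)
qed

lemma borel_measurable_ridge_newton:
  assumes [measurable]: "X \<in> measurable M sketch_space" "Y \<in> borel_measurable M"
  shows "(\<lambda>\<omega>. ridge_newton \<epsilon> (X \<omega>) (Y \<omega>) $ k) \<in> borel_measurable M"
proof -
  have [measurable]: "(\<lambda>\<omega>. sketch_gram (X \<omega>) (hessian f (Y \<omega>) *v axis j 1)) \<in> borel_measurable M" for j
    by (intro borel_measurable_sketch_gram measurable_compose[OF _ borel_measurable_hessian] assms)
  have [measurable]: "(\<lambda>\<omega>. sketch_gram (X \<omega>) (gradient f (Y \<omega>))) \<in> borel_measurable M"
    by (intro borel_measurable_sketch_gram measurable_compose[OF _ borel_measurable_gradient] assms)
  have [measurable]: "(\<lambda>\<omega>. ridge_matrix \<epsilon> (X \<omega>) (Y \<omega>) $ i $ j) \<in> borel_measurable M" for i j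
    unfolding ridge_matrix_def matrix_def by simp
  have [measurable]: "(\<lambda>\<omega>. det (ridge_matrix \<epsilon> (X \<omega>) (Y \<omega>))) \<in> borel_measurable M"
    by (rule borel_measurable_det) measurable
  have [measurable]: "(\<lambda>\<omega>. det (\<chi> i j. if j = k then sketch_gram (X \<omega>) (gradient f (Y \<omega>)) $ i
      else ridge_matrix \<epsilon> (X \<omega>) (Y \<omega>) $ i $ j)) \<in> borel_measurable M"
    by (rule borel_measurable_det) simp
  show ?thesis unfolding ridge_newton_def by simp
qed

lemma borel_measurable_sketched_newton [measurable]:
  assumes [measurable]: "X \<in> measurable M sketch_space" "Y \<in> borel_measurable M"
  shows "(\<lambda>\<omega>. sketched_newton f (X \<omega>) (Y \<omega>)) \<in> borel_measurable M"
  by (rule borel_measurable_vec_componentwise, rule borel_measurable_LIMSEQ_metric[OF _ ridge_newton_tendsto])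
    (intro borel_measurable_ridge_newton assms)

text \<open>This form avoids the Hessian in the stepsize, which makes its measurability immediate.\<close>
lemma local_norm_sketched_newton:
  "local_norm f x (sketched_newton f S x) = sqrt (sketched_newton f S x \<bullet> gradient f x)"
  using newton_direction_Galerkin[where u = "sketched_newton f S x" and S = S and x = x and g = "gradient f x"]
    positive_definite_hessian newton_direction_in_span[of f S x "gradient f x"]
  by (simp add: local_norm_def sketched_newton_def inner_commute)

lemma borel_measurable_sgn_step [measurable]:
  assumes [measurable]: "X \<in> measurable M sketch_space" "Y \<in> borel_measurable M"
  shows "(\<lambda>\<omega>. sgn_step La f (X \<omega>) (Y \<omega>)) \<in> borel_measurable M"
  unfolding sgn_step_eq[OF positive_definite_hessian] local_norm_sketched_newton by measurable

lemma borel_measurable_sgn_iterate: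
  assumes "\<And>j. j < k \<Longrightarrow> X j \<in> measurable M sketch_space"
  shows "(\<lambda>\<omega>. sgn_iterate La f x0 (\<lambda>j. X j \<omega>) k) \<in> borel_measurable M"
  using assms by (induction k) (auto intro: borel_measurable_sgn_step)

end

section \<open>Expected progress\<close>

text \<open>Independent variables may be averaged one after the other: \<open>T\<close> is frozen while the mean over \<open>Z\<close>
is taken.  Independence enters as the product form of the joint distribution, which makes sense for \<open>T\<close> and \<open>Z\<close>
of different types.\<close>
lemma (in prob_space) expectation_freezing:
  fixes F :: "'b \<times> 'c \<Rightarrow> real"
  assumes T: "T \<in> measurable M N" and Z: "Z \<in> measurable M K"
    and prod: "distr M N T \<Otimes>\<^sub>M distr M K Z = distr M (N \<Otimes>\<^sub>M K) (\<lambda>\<omega>. (T \<omega>, Z \<omega>))"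
    and F: "F \<in> borel_measurable (N \<Otimes>\<^sub>M K)"
    and bound: "\<And>y. \<bar>F y\<bar> \<le> B"
  shows "integrable M (\<lambda>\<omega>. \<integral>z. F (T \<omega>, z) \<partial>distr M K Z)"
    and "expectation (\<lambda>\<omega>. F (T \<omega>, Z \<omega>)) = expectation (\<lambda>\<omega>. \<integral>z. F (T \<omega>, z) \<partial>distr M K Z)"
proof -
  let ?DT = "distr M N T" and ?DZ = "distr M K Z"
  have TZ: "(\<lambda>\<omega>. (T \<omega>, Z \<omega>)) \<in> measurable M (N \<Otimes>\<^sub>M K)" using T Z by (rule measurable_Pair)
  interpret DT: prob_space ?DT by (rule prob_space_distr[OF T])
  interpret DZ: prob_space ?DZ by (rule prob_space_distr[OF Z])
  interpret P: pair_prob_space ?DT ?DZ ..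
  have F': "F \<in> borel_measurable (?DT \<Otimes>\<^sub>M ?DZ)" using F by (simp add: prod)
  have int: "integrable (?DT \<Otimes>\<^sub>M ?DZ) F"
    using bound F' by (intro P.P.integrable_const_bound[of _ B]) auto
  have m: "(\<lambda>t. \<integral>z. F (t, z) \<partial>?DZ) \<in> borel_measurable N"
    using DZ.borel_measurable_lebesgue_integral[of "\<lambda>t z. F (t, z)" N] F
    by (simp cong: measurable_cong_sets add: measurable_cong_sets[OF sets_pair_measure_cong[OF refl sets_distr] refl])
  have "integrable ?DT (\<lambda>t. \<integral>z. F (t, z) \<partial>?DZ)" using int by (rule P.integrable_fst')
  then show "integrable M (\<lambda>\<omega>. \<integral>z. F (T \<omega>, z) \<partial>?DZ)" by (rule integrable_distr[OF T])
  have "expectation (\<lambda>\<omega>. F (T \<omega>, Z \<omega>)) = integral\<^sup>L (?DT \<Otimes>\<^sub>M ?DZ) F"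
    unfolding prod by (rule integral_distr[OF TZ F, symmetric])
  also have "\<dots> = (\<integral>t. \<integral>z. F (t, z) \<partial>?DZ \<partial>?DT)" by (rule P.integral_fst'[OF int, symmetric])
  also have "\<dots> = expectation (\<lambda>\<omega>. \<integral>z. F (T \<omega>, z) \<partial>?DZ)" by (rule integral_distr[OF T m])
  finally show "expectation (\<lambda>\<omega>. F (T \<omega>, Z \<omega>)) = expectation (\<lambda>\<omega>. \<integral>z. F (T \<omega>, z) \<partial>?DZ)" .
qed

lemma sgn_iterate_cong:
  "(\<And>j. j < k \<Longrightarrow> S j = S' j) \<Longrightarrow> sgn_iterate L f x0 S k = sgn_iterate L f x0 S' k"
  by (induction k) auto

context self_concordant_function
begin

lemma sgn_iterate_descent:
  assumes "L \<le> La" "0 \<le> La"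
  shows "f (sgn_iterate La f x0 S k) \<le> f x0"
  by (induction k) (auto intro: order_trans[OF sgn_step_descent[OF assms]])

lemma projection_in_span: "projection f x S *v h \<in> span (set S)"
  by (simp add: projection_mult_vec[OF positive_definite_hessian] newton_direction_in_span)

text \<open>\<open>P_x\<close> is an orthogonal projection for the local inner product; the point of this form is that the
right-hand side is linear in \<open>P_x\<close>.\<close>
lemma local_norm_projection:
  "(local_norm f x (projection f x S *v h))\<^sup>2 = (projection f x S *v h) \<bullet> (hessian f x *v h)"
  using newton_direction_Galerkin[where x = x and S = S and g = "hessian f x *v h"
      and u = "projection f x S *v h"] positive_definite_hessian projection_in_span[of x S h]
  by (simp add: local_norm_power2 positive_definite_hessian inner_commute
      projection_mult_vec[OF positive_definite_hessian])

lemma local_norm_projection_le: "local_norm f x (projection f x S *v h) \<le> local_norm f x h"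
proof -
  let ?n = "local_norm f x (projection f x S *v h)"
  note pd = positive_definite_hessian
  have "?n\<^sup>2 = (hessian f x *v h) \<bullet> (projection f x S *v h)"
    by (simp add: local_norm_projection inner_commute)
  also have "\<dots> \<le> local_norm f x h * ?n"
    using positive_definite_Cauchy_Schwarz[OF pd, of x h "projection f x S *v h"]
    unfolding local_norm_def by linarith
  finally have "?n * ?n \<le> local_norm f x h * ?n" by (simp add: power2_eq_square)
  then show ?thesis
    using local_norm_nonneg[OF pd, of x "projection f x S *v h"] local_norm_nonneg[OF pd, of x h]
    by (cases "?n = 0") (simp, metis less_eq_real_def mult_le_cancel_right_pos)
qed

text \<open>The model at \<open>w = P_x h\<close>, with one of the three factors \<open>norm w\<close> in its cubic term bounded by
\<open>norm h\<close>, is an affine function of \<open>P_x\<close>.  Its mean thus depends only on the mean of \<open>P_x\<close>.\<close>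
lemma sgn_step_le_projected_model:
  assumes La: "L \<le> La" "0 \<le> La"
  shows "f (sgn_step La f S x) \<le> f x + (projection f x S *v h) \<bullet>
    (gradient f x + (1 / 2 + La / 6 * local_norm f x h) *\<^sub>R (hessian f x *v h))"
proof -
  let ?w = "projection f x S *v h"
  have "local_norm f x ?w ^ 3 = local_norm f x ?w * (local_norm f x ?w)\<^sup>2"
    by (simp add: power2_eq_square power3_eq_cube)
  also have "\<dots> \<le> local_norm f x h * (local_norm f x ?w)\<^sup>2"
    by (intro mult_right_mono local_norm_projection_le) simp
  finally have "La / 6 * local_norm f x ?w ^ 3 \<le> La / 6 * (local_norm f x h * (local_norm f x ?w)\<^sup>2)"
    using La by (intro mult_left_mono) auto
  then show ?thesis
    using sgn_step_le_model[OF La projection_in_span[of x S h], of x] local_norm_projection[of x S h]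
    by (simp add: inner_add_right algebra_simps)
qed

end

text \<open>Integrability of \<open>P\<close> comes from the mean being nonzero, as the integral of a non-integrable function is 0.\<close>
lemma mean_of_matrix_form:
  fixes P :: "'s \<Rightarrow> real^'d^('d::finite)"
  assumes mean: "(\<integral>s. P s \<partial>D) = p *\<^sub>R Finite_Cartesian_Product.mat 1" and p: "p \<noteq> 0"
  shows "integrable D (\<lambda>s. (P s *v h) \<bullet> c)" "(\<integral>s. (P s *v h) \<bullet> c \<partial>D) = p * (h \<bullet> c)"
proof -
  have "(Finite_Cartesian_Product.mat 1 :: real^'d^'d) \<noteq> 0"
  proof
    assume "(Finite_Cartesian_Product.mat 1 :: real^'d^'d) = 0"
    then have "(Finite_Cartesian_Product.mat 1 :: real^'d^'d) $ undefined $ undefined = 0" by simp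
    then show False by (simp add: Finite_Cartesian_Product.mat_def)
  qed
  then have "(\<integral>s. P s \<partial>D) \<noteq> 0" using mean p by simp
  then have int: "integrable D P" using not_integrable_integral_eq by blast
  have "linear (\<lambda>A :: real^'d^'d. (A *v h) \<bullet> c)"
    by (rule linearI) (simp_all add: matrix_vector_mult_add_rdistrib inner_add_left scaleR_matrix_vector_assoc[symmetric])
  then have bl: "bounded_linear (\<lambda>A :: real^'d^'d. (A *v h) \<bullet> c)" by (simp add: linear_conv_bounded_linear)
  show "integrable D (\<lambda>s. (P s *v h) \<bullet> c)" by (rule integrable_bounded_linear[OF bl int])
  have "(\<integral>s. (P s *v h) \<bullet> c \<partial>D) = ((\<integral>s. P s \<partial>D) *v h) \<bullet> c"
    by (rule integral_bounded_linear[OF bl int])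
  then show "(\<integral>s. (P s *v h) \<bullet> c \<partial>D) = p * (h \<bullet> c)"
    by (simp add: mean scaleR_matrix_vector_assoc[symmetric])
qed

text \<open>Here \<open>p\<close> stands for \<open>\<tau> / d\<close>.\<close>
locale sgn_setting = self_concordant_function f L + D: prob_space D
  for f :: "real^('d::finite) \<Rightarrow> real" and L :: real and D :: "'d sketch measure" +
  fixes La p :: real and xstar :: "real^'d"
  assumes convex: "convex_on UNIV f"
    and L_pos: "0 < L" and L_le_La: "L \<le> La"
    and minimizer: "f xstar \<le> f y"
    and sets_D: "sets D = sets sketch_space"
    and p_pos: "0 < p"
    and mean_projection: "(\<integral>S. projection f x S \<partial>D) = p *\<^sub>R Finite_Cartesian_Product.mat 1"
begin

lemma La_nonneg: "0 \<le> La" using L_pos L_le_La by simp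

lemma integrable_sgn_step: "integrable D (\<lambda>S. f (sgn_step La f S x))"
proof (rule D.integrable_const_bound[of _ "max \<bar>f x\<bar> \<bar>f xstar\<bar>"])
  have "\<bar>f (sgn_step La f S x)\<bar> \<le> max \<bar>f x\<bar> \<bar>f xstar\<bar>" for S
    using sgn_step_descent[OF L_le_La La_nonneg, of S x] minimizer[of "sgn_step La f S x"] by linarith
  then show "AE S in D. norm (f (sgn_step La f S x)) \<le> max \<bar>f x\<bar> \<bar>f xstar\<bar>" by simp
  have [measurable]: "(\<lambda>S. S) \<in> measurable D sketch_space"
    by (rule measurable_ident_sets[OF sets_D])
  show "(\<lambda>S. f (sgn_step La f S x)) \<in> borel_measurable D" by measurable
qed

lemma expected_step_le_model:
  "(\<integral>S. f (sgn_step La f S x) \<partial>D)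
    \<le> f x + p * (h \<bullet> gradient f x + (local_norm f x h)\<^sup>2 / 2 + La / 6 * local_norm f x h ^ 3)"
proof -
  let ?c = "gradient f x + (1 / 2 + La / 6 * local_norm f x h) *\<^sub>R (hessian f x *v h)"
  note mean = mean_of_matrix_form[OF mean_projection p_pos[THEN less_imp_neq, symmetric], of x h ?c]
  have "(\<integral>S. f (sgn_step La f S x) \<partial>D) \<le> (\<integral>S. f x + (projection f x S *v h) \<bullet> ?c \<partial>D)"
    by (intro integral_mono integrable_sgn_step Bochner_Integration.integrable_add D.integrable_const mean(1)
        sgn_step_le_projected_model L_le_La La_nonneg)
  also have "\<dots> = f x + p * (h \<bullet> ?c)"
    using mean by (simp add: D.prob_space)
  also have "h \<bullet> ?c = h \<bullet> gradient f x + (local_norm f x h)\<^sup>2 / 2 + La / 6 * local_norm f x h ^ 3"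
    using local_norm_power2[OF positive_definite_hessian, of x h]
    by (simp add: inner_add_right inner_commute[of "hessian f x *v h"] power2_eq_square power3_eq_cube algebra_simps)
  finally show ?thesis .
qed

text \<open>The factor \<open>\<eta>\<close> moves \<open>x\<close> part of the way to the minimiser: convexity makes the gain proportional to
\<open>\<eta>\<close>, while the model error is only \<open>\<eta>^3\<close>.\<close>
lemma expected_progress:
  assumes R: "local_norm f x (x - xstar) \<le> R" and \<eta>: "0 \<le> \<eta>" "\<eta> \<le> 1"
  shows "(\<integral>S. f (sgn_step La f S x) \<partial>D) - f xstar
    \<le> (1 - p * \<eta>) * (f x - f xstar) + p * ((La + L) * R ^ 3 / 6) * \<eta> ^ 3"
proof -
  note pd = positive_definite_hessian
  define h where "h = \<eta> *\<^sub>R (xstar - x)"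
  have h: "h = (- \<eta>) *\<^sub>R (x - xstar)" by (simp add: h_def scaleR_diff_right)
  have "local_norm f x h \<le> \<eta> * R"
    unfolding h local_norm_scaleR using R \<eta> by (simp add: mult_left_mono)
  then have h3: "local_norm f x h ^ 3 \<le> (\<eta> * R) ^ 3"
    by (intro power_mono local_norm_nonneg pd)
  have "f (x + h) = f ((1 - \<eta>) *\<^sub>R x + \<eta> *\<^sub>R xstar)" by (simp add: h_def algebra_simps)
  also have "\<dots> \<le> (1 - \<eta>) * f x + \<eta> * f xstar" using convex_onD[OF convex \<eta>] by simp
  finally have cvx: "f (x + h) \<le> (1 - \<eta>) * f x + \<eta> * f xstar" .
  have "h \<bullet> gradient f x + (local_norm f x h)\<^sup>2 / 2 + La / 6 * local_norm f x h ^ 3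
      \<le> f (x + h) - f x + (La + L) / 6 * local_norm f x h ^ 3"
    using cubic_lower_model[of x h] by (simp add: algebra_simps add_divide_distrib)
  also have "\<dots> \<le> - \<eta> * (f x - f xstar) + (La + L) / 6 * (\<eta> * R) ^ 3"
  proof -
    have "f (x + h) - f x \<le> - \<eta> * (f x - f xstar)" using cvx by (simp add: algebra_simps)
    moreover have "(La + L) / 6 * local_norm f x h ^ 3 \<le> (La + L) / 6 * (\<eta> * R) ^ 3"
      using h3 La_nonneg L_pos by (intro mult_left_mono) auto
    ultimately show ?thesis by linarith
  qed
  finally have "p * (h \<bullet> gradient f x + (local_norm f x h)\<^sup>2 / 2 + La / 6 * local_norm f x h ^ 3)
      \<le> p * (- \<eta> * (f x - f xstar) + (La + L) / 6 * (\<eta> * R) ^ 3)"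
    using p_pos by (intro mult_left_mono) auto
  then show ?thesis
    using expected_step_le_model[of x h] by (simp add: algebra_simps power_mult_distrib)
qed

end

locale sgn_process = sgn_setting f L D La p xstar + M: prob_space M
  for f :: "real^('d::finite) \<Rightarrow> real" and L D La p xstar and M :: "'w measure" +
  fixes S :: "nat \<Rightarrow> 'w \<Rightarrow> 'd sketch" and x0 :: "real^'d" and R :: real
  assumes indep: "M.indep_vars (\<lambda>_. sketch_space) S UNIV"
    and distr_S: "distr M sketch_space (S j) = D"
    and radius: "f x \<le> f x0 \<Longrightarrow> local_norm f x (x - xstar) \<le> R"
begin

definition iterate :: "nat \<Rightarrow> 'w \<Rightarrow> real^'d" where
  "iterate k \<omega> = sgn_iterate La f x0 (\<lambda>j. S j \<omega>) k"

lemma iterate_sublevel: "f (iterate k \<omega>) \<le> f x0"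
  unfolding iterate_def by (rule sgn_iterate_descent[OF L_le_La La_nonneg])

lemma measurable_S: "S j \<in> measurable M sketch_space"
  using indep by (simp add: M.indep_vars_def)

lemma measurable_iterate: "iterate k \<in> borel_measurable M"
  unfolding iterate_def[abs_def] by (intro borel_measurable_sgn_iterate measurable_S)

lemma integrable_iterate: "integrable M (\<lambda>\<omega>. f (iterate k \<omega>))"
proof (rule M.integrable_const_bound[of _ "max \<bar>f x0\<bar> \<bar>f xstar\<bar>"])
  have "\<bar>f (iterate k \<omega>)\<bar> \<le> max \<bar>f x0\<bar> \<bar>f xstar\<bar>" for \<omega>
    using iterate_sublevel[of k \<omega>] minimizer[of "iterate k \<omega>"] by linarith
  then show "AE \<omega> in M. norm (f (iterate k \<omega>)) \<le> max \<bar>f x0\<bar> \<bar>f xstar\<bar>" by simp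
  show "(\<lambda>\<omega>. f (iterate k \<omega>)) \<in> borel_measurable M"
    by (rule measurable_compose[OF measurable_iterate borel_measurable_f])
qed

text \<open>The iterate is a function of the sketches before the \<open>k\<close>-th.  The joint
distribution of the families over \<open>{..<k}\<close> and \<open>{k}\<close> is a product, and mapping it forward keeps it one.\<close>
lemma distr_iterate_sketch:
  "distr M borel (iterate k) \<Otimes>\<^sub>M distr M sketch_space (S k)
    = distr M (borel \<Otimes>\<^sub>M sketch_space) (\<lambda>\<omega>. (iterate k \<omega>, S k \<omega>))"
proof -
  define N K where "N = (PiM {..<k} (\<lambda>_. sketch_space) :: (nat \<Rightarrow> 'd sketch) measure)"
    and "K = (PiM {k} (\<lambda>_. sketch_space) :: (nat \<Rightarrow> 'd sketch) measure)"
  define T Z where "T \<omega> = (\<lambda>j\<in>{..<k}. S j \<omega>)" and "Z \<omega> = (\<lambda>j\<in>{k}. S j \<omega>)" for \<omega>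
  define Y where "Y t = sgn_iterate La f x0 t k" for t
  have "M.indep_var N T K Z"
    unfolding N_def K_def T_def[abs_def] Z_def[abs_def] by (rule M.indep_var_restrict[OF indep]) auto
  then have T: "T \<in> measurable M N" and Z: "Z \<in> measurable M K"
    and prod: "distr M N T \<Otimes>\<^sub>M distr M K Z = distr M (N \<Otimes>\<^sub>M K) (\<lambda>\<omega>. (T \<omega>, Z \<omega>))"
    by (simp_all add: M.indep_var_distribution_eq)
  have Y: "Y \<in> measurable N borel"
    unfolding Y_def[abs_def] N_def
    by (rule borel_measurable_sgn_iterate[where X = "\<lambda>j t. t j"]) (auto intro: measurable_component_singleton)
  have e: "(\<lambda>z. z k) \<in> measurable K sketch_space"
    unfolding K_def by (rule measurable_component_singleton) simp
  have it: "iterate k = Y \<circ> T"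
    by (auto simp: fun_eq_iff iterate_def Y_def T_def intro!: sgn_iterate_cong)
  have Sk: "S k = (\<lambda>z. z k) \<circ> Z" by (simp add: fun_eq_iff Z_def)
  have Ye: "(\<lambda>(t, z). (Y t, z k)) \<in> measurable (N \<Otimes>\<^sub>M K) (borel \<Otimes>\<^sub>M sketch_space)"
    unfolding split_beta
    by (intro measurable_Pair measurable_compose[OF measurable_fst Y] measurable_compose[OF measurable_snd e])
  interpret DZ: prob_space "distr M K Z" by (rule M.prob_space_distr[OF Z])
  interpret DS: prob_space "distr (distr M K Z) sketch_space (\<lambda>z. z k)"
    using e by (intro DZ.prob_space_distr) simp
  have "distr M borel (iterate k) \<Otimes>\<^sub>M distr M sketch_space (S k)
      = distr (distr M N T) borel Y \<Otimes>\<^sub>M distr (distr M K Z) sketch_space (\<lambda>z. z k)"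
    unfolding it Sk by (simp only: distr_distr[OF Y T] distr_distr[OF e Z])
  also have "\<dots> = distr (distr M N T \<Otimes>\<^sub>M distr M K Z) (borel \<Otimes>\<^sub>M sketch_space) (\<lambda>(t, z). (Y t, z k))"
    using Y e DS.sigma_finite_measure_axioms by (intro pair_measure_distr) auto
  also have "\<dots> = distr M (borel \<Otimes>\<^sub>M sketch_space) ((\<lambda>(t, z). (Y t, z k)) \<circ> (\<lambda>\<omega>. (T \<omega>, Z \<omega>)))"
    unfolding prod by (rule distr_distr[OF Ye measurable_Pair[OF T Z]])
  also have "(\<lambda>(t, z). (Y t, z k)) \<circ> (\<lambda>\<omega>. (T \<omega>, Z \<omega>)) = (\<lambda>\<omega>. (iterate k \<omega>, S k \<omega>))"
    by (simp add: it Sk fun_eq_iff)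
  finally show ?thesis .
qed

lemma expected_gap_recursion:
  assumes \<eta>: "0 \<le> \<eta>" "\<eta> \<le> 1"
  shows "M.expectation (\<lambda>\<omega>. f (iterate (Suc k) \<omega>)) - f xstar
    \<le> (1 - p * \<eta>) * (M.expectation (\<lambda>\<omega>. f (iterate k \<omega>)) - f xstar)
      + p * ((La + L) * R ^ 3 / 6) * \<eta> ^ 3"
proof -
  let ?B = "max \<bar>f x0\<bar> \<bar>f xstar\<bar>" and ?C = "p * ((La + L) * R ^ 3 / 6) * \<eta> ^ 3"
  \<comment> \<open>Clipping extends to every \<open>x\<close> the bound that \<open>f\<close> after one step has for \<open>x\<close> in the sublevel set
    of the iterates.\<close>
  define F where "F = (\<lambda>(x, s). max (- ?B) (min ?B (f (sgn_step La f s x))))"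
  have F_eq: "F (x, s) = f (sgn_step La f s x)" if "f x \<le> f x0" for x s
  proof -
    have "- ?B \<le> f (sgn_step La f s x)" "f (sgn_step La f s x) \<le> ?B"
      using that sgn_step_descent[OF L_le_La La_nonneg, of s x] minimizer[of "sgn_step La f s x"]
      by linarith+
    then show ?thesis unfolding F_def case_prod_conv by (simp only: min_absorb2 max_absorb2)
  qed
  have "(\<lambda>y. f (sgn_step La f (snd y) (fst y))) \<in> borel_measurable (borel \<Otimes>\<^sub>M sketch_space)"
    by (rule measurable_compose[OF borel_measurable_sgn_step[OF measurable_snd measurable_fst] borel_measurable_f])
  then have F: "F \<in> borel_measurable (borel \<Otimes>\<^sub>M sketch_space)"
    unfolding F_def split_beta by (intro borel_measurable_max borel_measurable_min borel_measurable_const)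
  have bound: "\<bar>F y\<bar> \<le> ?B" for y unfolding F_def by (cases y) (simp only: case_prod_conv, linarith)
  note freeze = M.expectation_freezing[OF measurable_iterate measurable_S distr_iterate_sketch F bound]
  have "M.expectation (\<lambda>\<omega>. f (iterate (Suc k) \<omega>)) = M.expectation (\<lambda>\<omega>. F (iterate k \<omega>, S k \<omega>))"
    by (simp add: F_eq[OF iterate_sublevel]) (simp add: iterate_def)
  also have "\<dots> = M.expectation (\<lambda>\<omega>. \<integral>s. F (iterate k \<omega>, s) \<partial>D)"
    using freeze(2)[of k] by (simp add: distr_S)
  also have "\<dots> \<le> M.expectation (\<lambda>\<omega>. f xstar + ((1 - p * \<eta>) * (f (iterate k \<omega>) - f xstar) + ?C))"
  proof (rule integral_mono)
    show "integrable M (\<lambda>\<omega>. \<integral>s. F (iterate k \<omega>, s) \<partial>D)"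
      using freeze(1)[of k] by (simp add: distr_S)
    show "integrable M (\<lambda>\<omega>. f xstar + ((1 - p * \<eta>) * (f (iterate k \<omega>) - f xstar) + ?C))"
      by (intro Bochner_Integration.integrable_add Bochner_Integration.integrable_diff
          integrable_mult_right M.integrable_const integrable_iterate)
    show "(\<integral>s. F (iterate k \<omega>, s) \<partial>D) \<le> f xstar + ((1 - p * \<eta>) * (f (iterate k \<omega>) - f xstar) + ?C)" for \<omega>
      using expected_progress[OF radius[OF iterate_sublevel] \<eta>, of k \<omega>]
      by (simp add: F_eq[OF iterate_sublevel])
  qed
  also have "\<dots> = f xstar + ((1 - p * \<eta>) * (M.expectation (\<lambda>\<omega>. f (iterate k \<omega>)) - f xstar) + ?C)"
    using integrable_iterate[of k] by (simp add: M.prob_space)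
  finally show ?thesis by simp
qed

end

section \<open>The convergence rate\<close>

text \<open>Choose \<open>\<eta>\<close> in the step to index \<open>n\<close> such that \<open>p \<eta> = n^2 / A n\<close>, where \<open>A n\<close> accumulates the weights \<open>n^2\<close>.  Then
\<open>A n * \<delta> n\<close> grows by at most \<open>C u^2 (n^2)^3 / (A n)^2 \<le> 9 C u^2\<close> with \<open>u = 1 / p\<close>, and dividing by
\<open>A n \<ge> n^3 / 3\<close> gives the rate.  The initial weight \<open>4 / 3 * u^3\<close> is the least that keeps \<open>\<eta> \<le> 1\<close> by way of
\<open>A n \<ge> 4 / 3 * u^3 + n^3 / 3\<close>, because \<open>4 u^3 + t^3 - 3 u t^2 = (t - 2 u)^2 (t + u)\<close>.\<close>
lemma cubic_recursion_rate:
  fixes \<delta> :: "nat \<Rightarrow> real"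
  assumes p: "0 < p" and C: "0 \<le> C" and \<delta>0: "0 \<le> \<delta> 0"
    and rec: "\<And>k \<eta>. 0 \<le> \<eta> \<Longrightarrow> \<eta> \<le> 1 \<Longrightarrow> \<delta> (Suc k) \<le> (1 - p * \<eta>) * \<delta> k + p * C * \<eta> ^ 3"
    and k: "1 \<le> k"
  shows "\<delta> k \<le> 4 * \<delta> 0 / (p ^ 3 * real k ^ 3) + 27 * C / (p\<^sup>2 * real k ^ 2)"
proof -
  define u where "u = 1 / p"
  have u: "0 < u" and pu: "p * u = 1" using p by (simp_all add: u_def)
  define A where "A k = 4 / 3 * u ^ 3 + (\<Sum>j\<le>k. (real j)\<^sup>2)" for k
  have sum_ge: "real n ^ 3 / 3 \<le> (\<Sum>j\<le>n. (real j)\<^sup>2)" for n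
  proof (induction n)
    case (Suc n)
    then show ?case by (simp add: power2_eq_square power3_eq_cube algebra_simps)
  qed simp
  have A_ge: "4 / 3 * u ^ 3 + real n ^ 3 / 3 \<le> A n" for n
    using sum_ge[of n] by (simp add: A_def)
  have u3: "0 < u ^ 3" using u by simp
  have A_ge': "real n ^ 3 / 3 \<le> A n" for n using A_ge[of n] u3 by linarith
  have A_pos: "0 < A n" for n
  proof -
    have "0 \<le> real n ^ 3" by simp
    then show ?thesis using A_ge[of n] u3 by linarith
  qed
  have A_Suc: "A (Suc n) = A n + (real (Suc n))\<^sup>2" for n by (simp add: A_def)
  have weight: "u * (real n)\<^sup>2 \<le> A n" for n
  proof -
    have "0 \<le> (real n - 2 * u)\<^sup>2 * (real n + u)" using u by simp
    also have "\<dots> = 4 * u ^ 3 + real n ^ 3 - 3 * (u * (real n)\<^sup>2)"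
      by (simp add: power2_eq_square power3_eq_cube algebra_simps)
    finally show ?thesis using A_ge[of n] by linarith
  qed
  have potential: "A n * \<delta> n \<le> A 0 * \<delta> 0 + 9 * C * u\<^sup>2 * real n" for n
  proof (induction n)
    case (Suc n)
    define a where "a = (real (Suc n))\<^sup>2"
    define B where "B = A (Suc n)"
    have a: "0 \<le> a" and B: "0 < B" by (simp_all add: a_def B_def A_pos)
    define \<eta> where "\<eta> = u * (a / B)"
    have "0 \<le> \<eta>" using a B u by (simp add: \<eta>_def)
    have "\<eta> \<le> 1" using B weight[of "Suc n"] by (simp add: \<eta>_def a_def B_def)
    have p\<eta>: "p * \<eta> = a / B" using pu by (simp add: \<eta>_def flip: mult.assoc)
    have "p * \<eta> ^ 3 = (p * \<eta>) * \<eta>\<^sup>2" by (simp add: power2_eq_square power3_eq_cube)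
    also have "\<dots> = u\<^sup>2 * (a / B) ^ 3"
      unfolding p\<eta> by (simp add: \<eta>_def power2_eq_square power3_eq_cube mult_ac)
    finally have p\<eta>3: "p * \<eta> ^ 3 = u\<^sup>2 * (a / B) ^ 3" .
    have "(real (Suc n) ^ 3 / 3)\<^sup>2 \<le> B\<^sup>2"
      using A_ge'[of "Suc n"] unfolding B_def by (intro power_mono) auto
    moreover have "a ^ 3 = 9 * (real (Suc n) ^ 3 / 3)\<^sup>2"
      by (simp add: a_def power_divide flip: power_mult)
    ultimately have "a ^ 3 / B\<^sup>2 \<le> 9" using B by (simp add: pos_divide_le_eq)
    moreover have "B * (a / B) ^ 3 = a ^ 3 / B\<^sup>2"
      using B by (simp add: power_divide power2_eq_square power3_eq_cube)
    ultimately have cube: "B * (a / B) ^ 3 \<le> 9" by simp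
    have "B * \<delta> (Suc n) \<le> B * ((1 - p * \<eta>) * \<delta> n + p * C * \<eta> ^ 3)"
      using B rec[OF \<open>0 \<le> \<eta>\<close> \<open>\<eta> \<le> 1\<close>, of n] by (intro mult_left_mono) auto
    also have "\<dots> = B * (1 - p * \<eta>) * \<delta> n + B * (C * (p * \<eta> ^ 3))"
      by (simp only: distrib_left mult_ac)
    also have "B * (1 - p * \<eta>) = B - a" unfolding p\<eta> using B by (simp add: right_diff_distrib)
    also have "B - a = A n" by (simp add: B_def A_Suc a_def)
    also have "B * (C * (p * \<eta> ^ 3)) = C * u\<^sup>2 * (B * (a / B) ^ 3)" unfolding p\<eta>3 by (simp only: mult_ac)
    also have "\<dots> \<le> C * u\<^sup>2 * 9" using cube C by (intro mult_left_mono) auto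
    finally have "B * \<delta> (Suc n) \<le> A n * \<delta> n + C * u\<^sup>2 * 9" by simp
    then show ?case using Suc by (simp add: B_def algebra_simps)
  qed simp
  have kpos: "0 < real k ^ 3 / 3" using k by simp
  have num: "0 \<le> A 0 * \<delta> 0 + 9 * C * u\<^sup>2 * real k"
    using A_pos[of 0] \<delta>0 C by (intro add_nonneg_nonneg mult_nonneg_nonneg) auto
  have "\<delta> k \<le> (A 0 * \<delta> 0 + 9 * C * u\<^sup>2 * real k) / A k"
    using potential[of k] A_pos[of k] by (simp add: pos_le_divide_eq mult.commute)
  also have "\<dots> \<le> (A 0 * \<delta> 0 + 9 * C * u\<^sup>2 * real k) / (real k ^ 3 / 3)"
    by (rule divide_left_mono[OF A_ge' num mult_pos_pos[OF A_pos kpos]])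
  also have "\<dots> = 4 * \<delta> 0 * (u ^ 3 / real k ^ 3) + 27 * C * (u\<^sup>2 / real k ^ 2)"
    using k by (simp add: A_def add_divide_distrib power2_eq_square power3_eq_cube mult_ac)
  also have "\<dots> = 4 * \<delta> 0 / (p ^ 3 * real k ^ 3) + 27 * C / (p\<^sup>2 * real k ^ 2)"
    by (simp add: u_def power_divide)
  finally show ?thesis .
qed

theorem theorem2:
  fixes f :: "real^('d::finite) \<Rightarrow> real"
    and x0 xstar :: "real^'d"
    and L_semi L_alg R \<tau> :: real
    and D :: "'d sketch measure"
    and M :: "'w measure"
    and S :: "nat \<Rightarrow> 'w \<Rightarrow> 'd sketch"
    and k :: nat
  assumes "convex_on UNIV f"
    and "twice_differentiable f"
    and "\<forall>x. positive_definite (hessian f x)"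
    and "bdd_below (range f)"
    and "\<forall>y. f xstar \<le> f y"
    and "semi_strongly_self_concordant L_semi f"
    and "0 < L_semi" and "L_semi \<le> L_alg"
    and "sublevel_diameter f x0 = ereal R"
    and "prob_space D" and "sets D = sets sketch_space"
    and "0 < \<tau>"
    and "\<forall>x. (\<integral>S. projection f x S \<partial>D) = (\<tau> / real CARD('d)) *\<^sub>R Finite_Cartesian_Product.mat 1"
    and "prob_space M"
    and "prob_space.indep_vars M (\<lambda>_. sketch_space) S UNIV"
    and "\<forall>k. distr M sketch_space (S k) = D"
    and "1 \<le> k"
  shows "integrable M (\<lambda>\<omega>. f (sgn_iterate L_alg f x0 (\<lambda>j. S j \<omega>) k) - f xstar) \<and>
    prob_space.expectation M (\<lambda>\<omega>. f (sgn_iterate L_alg f x0 (\<lambda>j. S j \<omega>) k) - f xstar)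
      \<le> 4 * real CARD('d) ^ 3 * (f x0 - f xstar) / (\<tau> ^ 3 * real k ^ 3)
        + 9 * (L_alg + L_semi) * real CARD('d) ^ 2 * R ^ 3 / (2 * \<tau> ^ 2 * real k ^ 2)"
proof -
  have diameter: "local_norm f x (x - y) \<le> R" if "f x \<le> f x0" "f y \<le> f x0" for x y
  proof -
    have "ereal (local_norm f x (x - y)) \<le> sublevel_diameter f x0"
      unfolding sublevel_diameter_def
      by (rule SUP_upper2[of x], simp add: sublevel_def that, rule SUP_upper, simp add: sublevel_def that)
    then show ?thesis using assms by simp
  qed
  define p where "p = \<tau> / real CARD('d)"
  interpret M: prob_space M by fact
  interpret sgn_process f L_semi D L_alg p xstar M S x0 R
  proof (intro sgn_process.intro sgn_setting.intro self_concordant_function.intro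
      sgn_setting_axioms.intro sgn_process_axioms.intro)
    show "0 < p" using assms by (simp add: p_def)
    show "local_norm f x (x - xstar) \<le> R" if "f x \<le> f x0" for x
      using diameter that assms by blast
  qed (use assms in \<open>auto simp: p_def\<close>)
  have R: "0 \<le> R"
    using diameter[of x0 x0] by (simp add: local_norm_def)
  define \<delta> where "\<delta> k = M.expectation (\<lambda>\<omega>. f (iterate k \<omega>)) - f xstar" for k
  define C where "C = (L_alg + L_semi) * R ^ 3 / 6"
  have \<delta>0: "\<delta> 0 = f x0 - f xstar" by (simp add: \<delta>_def iterate_def M.prob_space)
  have e1: "4 * a / ((t / d) ^ 3 * n) = 4 * d ^ 3 * a / (t ^ 3 * n)"
    and e2: "27 * (a * r / 6) / ((t / d)\<^sup>2 * n) = 9 * a * d ^ 2 * r / (2 * t ^ 2 * n)"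
    for a d n r t :: real
    by (simp_all add: power_divide mult_ac)
  have "\<delta> k \<le> 4 * \<delta> 0 / (p ^ 3 * real k ^ 3) + 27 * C / (p\<^sup>2 * real k ^ 2)"
  proof (rule cubic_recursion_rate[OF p_pos])
    show "0 \<le> C" using R La_nonneg L_pos by (simp add: C_def)
    show "0 \<le> \<delta> 0" using minimizer by (simp add: \<delta>0)
    show "\<delta> (Suc k) \<le> (1 - p * \<eta>) * \<delta> k + p * C * \<eta> ^ 3" if "0 \<le> \<eta>" "\<eta> \<le> 1" for k \<eta>
      unfolding \<delta>_def C_def by (rule expected_gap_recursion[OF that])
  qed fact
  also have "4 * \<delta> 0 / (p ^ 3 * real k ^ 3)
      = 4 * real CARD('d) ^ 3 * (f x0 - f xstar) / (\<tau> ^ 3 * real k ^ 3)"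
    unfolding \<delta>0 p_def by (rule e1)
  also have "27 * C / (p\<^sup>2 * real k ^ 2)
      = 9 * (L_alg + L_semi) * real CARD('d) ^ 2 * R ^ 3 / (2 * \<tau> ^ 2 * real k ^ 2)"
    unfolding C_def p_def by (rule e2)
  finally have rate: "\<delta> k \<le> 4 * real CARD('d) ^ 3 * (f x0 - f xstar) / (\<tau> ^ 3 * real k ^ 3)
        + 9 * (L_alg + L_semi) * real CARD('d) ^ 2 * R ^ 3 / (2 * \<tau> ^ 2 * real k ^ 2)" .
  have int: "integrable M (\<lambda>\<omega>. f (sgn_iterate L_alg f x0 (\<lambda>j. S j \<omega>) k))"
    using integrable_iterate[of k] by (simp add: iterate_def)
  have "M.expectation (\<lambda>\<omega>. f (sgn_iterate L_alg f x0 (\<lambda>j. S j \<omega>) k) - f xstar) = \<delta> k"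
    using int by (simp add: \<delta>_def iterate_def M.prob_space)
  with rate int show ?thesis by (simp only: Bochner_Integration.integrable_diff M.integrable_const)
qed

end
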